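(* Let $\eta^6(\tau)\eta^6(3\tau)=\sum_{n\ge 1}a(n)q^n$ be the Fourier expansion of $\eta^6(\tau)\eta^6(3\tau)$, where $q=e^{2\pi i\tau}$. For any integer $n\ge 0$, $$A_{3,6}(n)=\frac{1}{39}\bigl(\sigma_{5,3}^{\#}(n+2)-a(n+2)\bigr).$$
   Context: A partition is called $t$-core if none of its hook numbers (hook lengths) is a multiple of $t$ (the empty partition is $t$-core). A partition $k$-tuple of $n$ is an ordered $k$-tuple $(\lambda_1,\ldots,\lambda_k)$ of (possibly empty) partitions such that the sum of all the parts of all the $\lambda_i$ equals $n$. $A_{t,k}(n)$ denotes the number of partition $k$-tuples of $n$ in which each $\lambda_i$ is $t$-core. The Dedekind eta function is $\eta(\tau)=q^{1/24}\prod_{m\ge 1}(1-q^m)$ with $q=e^{2\pi i\tau}$, $\tau$ in the complex upper half plane, and $\eta^r(m\tau)$ means $(\eta(m\tau))^r$. For a prime $p$, $\nu_p(n)$ denotes the largest integer $e$ such that $p^e\mid n$. For $n\ge 1$, $$\sigma_{5,3}^{\#}(n)=3^{5\nu_3(n)}\sum_{d\mid n,\ d\not\equiv 0\ (\mathrm{mod}\ 3)}d^5,$$ the sum being over positive divisors $d$ of $n$ not divisible by $3$. *)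

theory Defs
  imports "HOL-Analysis.Analysis" "HOL-Computational_Algebra.Primes"
begin

text \<open>A partition is the weakly decreasing list of its (positive) parts.\<close>

definition is_partition :: "nat list \<Rightarrow> bool" where
  "is_partition xs \<longleftrightarrow> sorted_wrt (\<ge>) xs \<and> (\<forall>x\<in>set xs. 0 < x)"

definition young_diagram :: "nat list \<Rightarrow> (nat \<times> nat) set" where
  "young_diagram xs = {(i, j). i < length xs \<and> j < xs ! i}"

text \<open>
  Rows and columns are indexed from 0. The two sets are the arm (the cells to the right of
  \<open>(i, j)\<close> in its row) and the leg (the cells below it in its column).
\<close>

definition hook_length :: "nat list \<Rightarrow> nat \<Rightarrow> nat \<Rightarrow> nat" where
  "hook_length xs i j =
     card {j'. j < j' \<and> (i, j') \<in> young_diagram xs} +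
     card {i'. i < i' \<and> (i', j) \<in> young_diagram xs} + 1"

definition is_core :: "nat \<Rightarrow> nat list \<Rightarrow> bool" where
  "is_core t xs \<longleftrightarrow> (\<forall>(i, j)\<in>young_diagram xs. \<not> t dvd hook_length xs i j)"

definition partition_tuples :: "nat \<Rightarrow> nat \<Rightarrow> nat list list set" where
  "partition_tuples k n =
     {ls. length ls = k \<and> (\<forall>xs\<in>set ls. is_partition xs) \<and> sum_list (map sum_list ls) = n}"

definition core_tuple_count :: "nat \<Rightarrow> nat \<Rightarrow> nat \<Rightarrow> nat" where
  "core_tuple_count t k n = card {ls \<in> partition_tuples k n. \<forall>xs\<in>set ls. is_core t xs}"

lemma finite_partition_tuples: "finite (partition_tuples k n)"
proof (rule finite_subset)
  let ?P = "{xs :: nat list. set xs \<subseteq> {..n} \<and> length xs \<le> n}"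
  have len: "length xs \<le> sum_list xs" if "\<forall>x\<in>set xs. 0 < x" for xs :: "nat list"
    using that by (induction xs) auto
  show "partition_tuples k n \<subseteq> {ls. set ls \<subseteq> ?P \<and> length ls = k}"
  proof
    fix ls assume ls: "ls \<in> partition_tuples k n"
    have "xs \<in> ?P" if "xs \<in> set ls" for xs
    proof -
      have "sum_list xs \<le> n"
        using ls that member_le_sum_list[of "sum_list xs" "map sum_list ls"]
        by (auto simp: partition_tuples_def)
      moreover have "length xs \<le> sum_list xs"
        using ls that by (intro len) (auto simp: partition_tuples_def is_partition_def)
      moreover have "x \<le> sum_list xs" if "x \<in> set xs" for x
        using that by (simp add: member_le_sum_list)
      ultimately show ?thesis by fastforce
    qed
    then show "ls \<in> {ls. set ls \<subseteq> ?P \<and> length ls = k}"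
      using ls by (auto simp: partition_tuples_def)
  qed
  show "finite {ls. set ls \<subseteq> ?P \<and> length ls = k}"
    by (intro finite_lists_length_eq finite_lists_length_le) auto
qed

definition nome :: "complex \<Rightarrow> complex" where
  "nome \<tau> = exp (2 * of_real pi * \<i> * \<tau>)"

text \<open>
  The factor \<open>q^(1/24)\<close> is \<open>exp (2 \<pi> \<i> \<tau> / 24)\<close>, not the principal 24th root of \<open>q\<close>.
\<close>

definition dedekind_eta :: "complex \<Rightarrow> complex" where
  "dedekind_eta \<tau> = exp (2 * of_real pi * \<i> * \<tau> / 24) * (\<Prod>m. 1 - nome \<tau> ^ Suc m)"

definition sigma_sharp_5_3 :: "nat \<Rightarrow> nat" where
  "sigma_sharp_5_3 n = 3 ^ (5 * multiplicity 3 n) * (\<Sum>d | d dvd n \<and> \<not> 3 dvd d. d ^ 5)"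

end

theory Submission
  imports Defs "HOL-Complex_Analysis.Cauchy_Integral_Formula" "HOL-Real_Asymp.Real_Asymp"
begin

text \<open>
Put \<open>\<phi>(q) = (1 - q)(1 - q^2)(1 - q^3)\<dots>\<close>. The 3-cores have generating function
\<open>\<phi>(q^3)^3 / \<phi>(q)\<close>, so the theorem says that
\<open>F = 39 q^2 (\<phi>(q^3)^3 / \<phi>(q))^6 + q \<phi>(q)^6 \<phi>(q^3)^6\<close>,
where \<open>F\<close> is the generating function of the divisor sum \<open>\<sigma>'\<close> of the theorem. Since \<open>\<sigma>'(n)\<close> is the sum of \<open>d^5\<close> over the
divisors \<open>d\<close> of \<open>n\<close> with \<open>n / d\<close> prime to 3, \<open>F\<close> is the fourth derivative of the Weierstrass function
\<open>\<wp>\<close> with nome \<open>Q = q^3\<close> at the point \<open>x = q\<close> of order three (multiplicative notation). This makes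
the identity a statement about elliptic functions at a torsion point.

Let \<open>\<zeta>\<^sub>k\<close> be the result of applying \<open>x d/dx\<close> \<open>k\<close> times to the Weierstrass zeta function, given
by its Laurent series. Two identities between Laurent coefficients carry the proof. The addition theorem
(\<open>three_term_identity\<close>) is a partial fraction identity for the coefficients \<open>1 / (1 - Q^n)\<close>; the heat
equation of the theta function (\<open>heat_identity\<close>) is a telescoping sum. Evaluated at \<open>x = q\<close>, together
with enough derivatives, they express \<open>\<zeta>\<^sub>3\<close>, \<open>\<zeta>\<^sub>4\<close> and \<open>\<zeta>\<^sub>5\<close> through \<open>a = 6 \<zeta>\<^sub>0 - 2\<close> and \<open>c = \<zeta>\<^sub>2\<close>
(\<open>torsion_relations\<close>); in particular \<open>F = \<zeta>\<^sub>5 = a^3 c + 12 c^2\<close>.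

Along the curve \<open>(x, Q) = (q, q^3)\<close> the operator \<open>q d/dq\<close> also differentiates with respect to \<open>Q\<close>, which
the same identities evaluate. So \<open>c\<close> and \<open>a^3 - 27 c\<close> satisfy first order linear differential equations.
The products \<open>q \<phi>(q^3)^9 / \<phi>(q)^3\<close> and \<open>\<phi>(q)^9 / \<phi>(q^3)^3\<close> satisfy the same equations with the same
behaviour at 0, hence they are \<open>c\<close> and \<open>a^3 - 27 c\<close> (\<open>zeta3_2_product\<close>, \<open>cubic_product\<close>; this is the
cubic identity of the Borweins). Therefore \<open>F = 39 c^2 + c (a^3 - 27 c)\<close> is the right-hand side above.

On the combinatorial side, the beta-set of a partition with at most \<open>N\<close> parts is a set of \<open>N\<close>
natural numbers, and the partition is a 3-core iff its beta-set is closed under subtraction of 3.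
Such a set is determined by its numbers of elements in the three residue classes. Sorting the factors of
Euler's product \<open>(1 + z)(1 + q z)(1 + q^2 z)\<dots>\<close> by the exponent of \<open>q\<close> modulo 3 and comparing the
coefficients of \<open>z^N\<close> thus gives a sum over 3-cores with at most \<open>N\<close> parts (\<open>core_sum_finite\<close>);
the generating function is its limit for large \<open>N\<close> (\<open>has_sum_cores\<close>).

All analytic identities are proved for real \<open>q\<close> between 0 and 1. This suffices, because a power series
is determined by its values there.
\<close>

section \<open>Absolutely convergent sums\<close>

lemma has_sum_times_real:
  fixes f :: "'a \<Rightarrow> real" and g :: "'b \<Rightarrow> real"
  assumes f: "(f has_sum A) X" and g: "(g has_sum B) Y"
  shows "((\<lambda>(x, y). f x * g y) has_sum A * B) (X \<times> Y)"
proof (rule has_sum_SigmaI)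
  show "((\<lambda>y. case (x, y) of (x, y) \<Rightarrow> f x * g y) has_sum f x * B) Y" for x
    using has_sum_cmult_right[OF g, of "f x"] by simp
  show "((\<lambda>x. f x * B) has_sum A * B) X"
    by (rule has_sum_cmult_left[OF f])
  have fa: "(\<lambda>x. \<bar>f x\<bar>) summable_on X" and ga: "(\<lambda>y. \<bar>g y\<bar>) summable_on Y"
    using has_sum_imp_summable[OF f, THEN summable_on_iff_abs_summable_on_real[THEN iffD1]]
      has_sum_imp_summable[OF g, THEN summable_on_iff_abs_summable_on_real[THEN iffD1]] by simp_all
  have "(\<lambda>(x, y). \<bar>f x\<bar> * \<bar>g y\<bar>) summable_on X \<times> Y"
  proof (rule summable_on_SigmaI)
    show "((\<lambda>y. case (x, y) of (x, y) \<Rightarrow> \<bar>f x\<bar> * \<bar>g y\<bar>) has_sum \<bar>f x\<bar> * infsum (\<lambda>y. \<bar>g y\<bar>) Y) Y" for x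
      using has_sum_cmult_right[OF has_sum_infsum[OF ga], of "\<bar>f x\<bar>"] by simp
    show "(\<lambda>x. \<bar>f x\<bar> * infsum (\<lambda>y. \<bar>g y\<bar>) Y) summable_on X"
      by (rule summable_on_cmult_left[OF fa])
  qed auto
  then show "(\<lambda>(x, y). f x * g y) summable_on X \<times> Y"
    by (subst summable_on_iff_abs_summable_on_real) (simp add: case_prod_unfold abs_mult)
qed

lemma has_sum_diff_real:
  fixes f g :: "'a \<Rightarrow> real"
  assumes "(f has_sum a) A" "(g has_sum b) A"
  shows "((\<lambda>x. f x - g x) has_sum (a - b)) A"
  using has_sum_add[OF assms(1) has_sum_cmult_right[OF assms(2), of "-1"]] by simp

lemma summable_poly_geometric:
  assumes "0 < r" "r < (1::real)"
  shows "summable (\<lambda>n. real n ^ k * r ^ n)"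
proof (rule summable_comparison_test_ev)
  \<comment> \<open>Any number strictly between \<open>r\<close> and 1 leads to a convergent majorant.\<close>
  define t where "t = (1 + r) / 2"
  have t: "r < t" "0 < t" "t < 1" using assms by (auto simp: t_def)
  have "(\<lambda>n. real n ^ k * (r / t) ^ n) \<longlonglongrightarrow> 0"
    using t assms by real_asymp
  then have "eventually (\<lambda>n. norm (real n ^ k * (r / t) ^ n) < 1) sequentially"
    by (metis (no_types, lifting) LIMSEQ_iff diff_zero eventually_sequentially zero_less_one)
  then show "eventually (\<lambda>n. norm (real n ^ k * r ^ n) \<le> t ^ n) sequentially"
    by eventually_elim (use t assms in \<open>auto simp: power_divide abs_mult field_simps\<close>)
  show "summable (\<lambda>n. t ^ n)" using t by (simp add: summable_geometric)
qed

lemma summable_on_int_poly_geometric: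
  assumes "0 < r" "r < (1::real)"
  shows "(\<lambda>n::int. real_of_int \<bar>n\<bar> ^ k * r ^ nat \<bar>n\<bar>) summable_on UNIV"
proof -
  have nat: "(\<lambda>n. real n ^ k * r ^ n) summable_on UNIV"
    using summable_poly_geometric[OF assms, of k] assms
    by (intro norm_summable_imp_summable_on) (simp add: abs_mult)
  have pos: "(\<lambda>n::int. real_of_int \<bar>n\<bar> ^ k * r ^ nat \<bar>n\<bar>) summable_on {0..}"
    by (rule summable_on_reindex_bij_witness[of UNIV nat int, THEN iffD1, OF _ _ _ _ _ nat]) auto
  have neg: "(\<lambda>n::int. real_of_int \<bar>n\<bar> ^ k * r ^ nat \<bar>n\<bar>) summable_on {..0}"
    by (rule summable_on_reindex_bij_witness[of "{0..}" uminus uminus, THEN iffD1, OF _ _ _ _ _ pos]) auto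
  have "(UNIV::int set) = {0..} \<union> {..0}" by auto
  then show ?thesis using summable_on_union[OF pos neg] by metis
qed

section \<open>The addition theorem for the Weierstrass zeta function\<close>

text \<open>
The Laurent coefficients, in the annulus \<open>Q < \<bar>x\<bar> < 1\<close>, of the logarithmic derivative of the theta
function with nome \<open>Q\<close>; up to sign and a linear term this is the Weierstrass zeta function. The
value \<open>1 / 2\<close> at 0 makes that function odd, see \<open>zeta_reflect\<close>.
\<close>
definition kern :: "real \<Rightarrow> int \<Rightarrow> real" where
  "kern Q n = (if n = 0 then 1 / 2 else 1 / (1 - Q powi n))"

text \<open>
For \<open>n \<noteq> 0\<close> this is \<open>Q d/dQ\<close> of \<open>kern Q n\<close>, divided by \<open>n\<close>.
\<close>
definition dkern :: "real \<Rightarrow> int \<Rightarrow> real" where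
  "dkern Q n = (if n = 0 then 0 else Q powi n / (1 - Q powi n)\<^sup>2)"

text \<open>
The parameter \<open>k\<close> counts applications of \<open>x d/dx\<close>. Thus \<open>zeta 1\<close> is a normalization of the function \<open>\<wp>\<close>, and \<open>zeta (k + 1)\<close> is its \<open>k\<close>-th derivative. The series \<open>xi\<close> is the correction term in the addition
theorem and in the heat equation.
\<close>
definition zeta :: "nat \<Rightarrow> real \<Rightarrow> real \<Rightarrow> real" where
  "zeta k Q x = (\<Sum>\<^sub>\<infinity>n::int. of_int n ^ k * kern Q n * x powi n)"

definition xi :: "nat \<Rightarrow> real \<Rightarrow> real \<Rightarrow> real" where
  "xi k Q x = (\<Sum>\<^sub>\<infinity>n::int. of_int n ^ k * dkern Q n * x powi n)"

lemma powi_neq_1: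
  assumes "0 < Q" "Q < (1::real)" "n \<noteq> 0"
  shows "Q powi n \<noteq> 1"
proof (cases "n > 0")
  case True
  then have "Q powi n = Q ^ nat n" by (simp add: power_int_def)
  moreover have "Q ^ nat n < 1" using assms True by (simp add: power_less_one_iff)
  ultimately show ?thesis by simp
next
  case False
  then have "Q powi n = inverse (Q ^ nat (-n))" using assms by (simp add: power_int_def power_inverse)
  moreover have "Q ^ nat (-n) < 1" using assms False by (simp add: power_less_one_iff)
  ultimately show ?thesis by (metis inverse_1 inverse_inverse_eq less_irrefl)
qed

lemma kern_minus:
  assumes "0 < Q" "Q < 1"
  shows "kern Q (- n) = 1 - kern Q n"
proof (cases "n = 0")
  case False
  define A where "A = Q powi n"
  have A: "A \<noteq> 1" "A > 0" using powi_neq_1[OF assms False] assms by (auto simp: A_def)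
  have "1 - inverse A = - ((1 - A) / A)" using A by (simp add: field_simps)
  then have "1 / (1 - inverse A) = 1 - 1 / (1 - A)" using A by (simp add: divide_simps) (simp add: algebra_simps)
  then show ?thesis using False by (simp add: kern_def A_def power_int_minus)
qed (simp add: kern_def)

lemma dkern_minus:
  assumes "0 < Q" "Q < 1"
  shows "dkern Q (- n) = dkern Q n"
proof (cases "n = 0")
  case False
  define A where "A = Q powi n"
  have A: "A \<noteq> 1" "A > 0" using powi_neq_1[OF assms False] assms by (auto simp: A_def)
  have "inverse A / (1 - inverse A)\<^sup>2 = A / (1 - A)\<^sup>2"
  proof -
    have "1 - inverse A = - ((1 - A) / A)" using A by (simp add: field_simps)
    then show ?thesis using A by (simp add: power_divide power2_eq_square field_simps)
  qed
  then show ?thesis using False by (simp add: dkern_def A_def power_int_minus)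
qed (simp add: dkern_def)

lemma dkern_eq:
  assumes "0 < Q" "Q < 1" "n \<noteq> 0"
  shows "dkern Q n = kern Q n ^ 2 - kern Q n"
proof -
  define A where "A = Q powi n"
  have "1 - A \<noteq> 0" using powi_neq_1[OF assms] by (auto simp: A_def)
  then have "A / (1 - A)\<^sup>2 = (1 / (1 - A))\<^sup>2 - 1 / (1 - A)"
    by (simp add: power_divide power2_eq_square divide_simps)
  then show ?thesis using assms by (simp add: dkern_def kern_def A_def)
qed

text \<open>
The partial fraction identity behind the addition theorem: with \<open>A = Q^m\<close> and \<open>B = Q^n\<close> it
is a relation between \<open>1 / (1 - A)\<close>, \<open>1 / (1 - B)\<close>, \<open>1 / (1 - A / B)\<close> and \<open>1 / (1 - B / A)\<close>.
\<close>
lemma kern_three_term: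
  assumes Q: "0 < Q" "Q < 1" and "m \<noteq> 0" "n \<noteq> 0" "m \<noteq> n"
  shows "kern Q m * kern Q n - kern Q (m - n) * kern Q n - kern Q (n - m) * kern Q m = 0"
proof -
  define A B where "A = Q powi m" and "B = Q powi n"
  have AB: "A \<noteq> 1" "B \<noteq> 1" "A \<noteq> 0" "B \<noteq> 0" "A / B \<noteq> 1"
    using powi_neq_1[OF Q, of m] powi_neq_1[OF Q, of n] powi_neq_1[OF Q, of "m - n"] assms
    by (auto simp: A_def B_def power_int_diff)
  have k: "kern Q m = 1 / (1 - A)" "kern Q n = 1 / (1 - B)"
    "kern Q (m - n) = 1 / (1 - A / B)" "kern Q (n - m) = 1 / (1 - B / A)"
    using assms by (auto simp: kern_def A_def B_def power_int_diff)
  have *: "1 / (1 - A / B) = B / (B - A)" "1 / (1 - B / A) = A / (A - B)"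
    using AB by (auto simp: field_simps)
  have nz: "B - A \<noteq> 0" "1 - A \<noteq> 0" "1 - B \<noteq> 0" using AB by auto
  have "A / (A - B) = - (A / (B - A))" by (metis minus_diff_eq divide_minus_right)
  then show ?thesis unfolding k * using nz by (simp add: divide_simps) (simp add: algebra_simps)
qed

text \<open>
The decay for negative \<open>n\<close> is what makes the Laurent series converge down to \<open>\<bar>x\<bar> = Q\<close>.
\<close>
lemma kern_bound:
  assumes Q: "0 < Q" "Q < 1"
  shows "\<bar>kern Q n\<bar> \<le> Q ^ nat (- n) / (1 - Q)"
proof -
  consider "n = 0" | "n > 0" | "n < 0" by linarith
  then show ?thesis
  proof cases
    case 1
    then show ?thesis using Q by (simp add: kern_def field_simps)
  next
    case 2
    have "Q ^ nat n \<le> Q ^ 1" using 2 Q by (intro power_decreasing) auto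
    then show ?thesis using 2 Q
      by (simp add: kern_def power_int_def frac_le)
  next
    case 3
    define d where "d = nat (- n)"
    have d: "d > 0" "n = - int d" using 3 by (auto simp: d_def)
    have l: "Q ^ d \<le> Q ^ 1" using d Q by (intro power_decreasing) auto
    have "kern Q n = - (Q ^ d / (1 - Q ^ d))"
      using d Q l by (simp add: kern_def power_int_minus field_simps)
    moreover have "Q ^ d / (1 - Q ^ d) \<le> Q ^ d / (1 - Q)"
      using Q l by (intro divide_left_mono) auto
    ultimately show ?thesis using d Q l by simp
  qed
qed

lemma dkern_bound:
  assumes Q: "0 < Q" "Q < 1"
  shows "\<bar>dkern Q n\<bar> \<le> Q ^ nat \<bar>n\<bar> / (1 - Q)\<^sup>2"
proof -
  have pos: "\<bar>dkern Q n\<bar> \<le> Q ^ nat \<bar>n\<bar> / (1 - Q)\<^sup>2" if "n \<ge> 0" for n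
  proof (cases "n = 0")
    case False
    have "Q ^ nat n \<le> Q ^ 1" using False that Q by (intro power_decreasing) auto
    then have "(1 - Q)\<^sup>2 \<le> (1 - Q ^ nat n)\<^sup>2" using Q by (intro power_mono) auto
    moreover have "0 < (1 - Q)\<^sup>2" using Q by simp
    ultimately have "Q ^ nat n / (1 - Q ^ nat n)\<^sup>2 \<le> Q ^ nat n / (1 - Q)\<^sup>2"
      using Q by (intro frac_le) auto
    then show ?thesis using False that Q by (simp add: dkern_def power_int_def)
  qed (auto simp: dkern_def)
  show ?thesis using pos[of "\<bar>n\<bar>"] dkern_minus[OF Q, of n] by (cases "n \<ge> 0") auto
qed

lemma annulus_bound:
  assumes Q: "0 < Q" "Q < x" "x < (1::real)"
  defines "r \<equiv> max x (Q / x)"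
  shows "0 < r" "r < 1"
    "Q ^ nat (- n) * x powi n \<le> r ^ nat \<bar>n\<bar>" "Q ^ nat \<bar>n\<bar> * x powi n \<le> r ^ nat \<bar>n\<bar>"
proof -
  have x: "0 < x" using Q by simp
  show "0 < r" "r < 1" using Q x by (auto simp: r_def)
  have neg: "Q ^ nat (- n) * x powi n = (Q / x) ^ nat (- n)" if "n < 0"
    using that x by (simp add: power_int_def power_divide field_simps)
  have neg': "(Q / x) ^ nat (- n) \<le> r ^ nat (-n)" using Q x by (intro power_mono) (auto simp: r_def)
  have pos: "x ^ nat n \<le> r ^ nat n" using x by (intro power_mono) (auto simp: r_def)
  show "Q ^ nat (- n) * x powi n \<le> r ^ nat \<bar>n\<bar>"
    using neg neg' pos by (cases "n < 0") (auto simp: power_int_def)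
  moreover have "Q ^ nat \<bar>n\<bar> * x powi n \<le> Q ^ nat (- n) * x powi n"
    using Q x by (intro mult_right_mono power_decreasing) auto
  ultimately show "Q ^ nat \<bar>n\<bar> * x powi n \<le> r ^ nat \<bar>n\<bar>" by linarith
qed

lemma has_sum_by_geometric_bound:
  fixes f :: "int \<Rightarrow> real"
  assumes "0 < r" "r < 1" and b: "\<And>n. \<bar>f n\<bar> \<le> c * (of_int \<bar>n\<bar> ^ k * r ^ nat \<bar>n\<bar>)"
  shows "(f has_sum infsum f UNIV) UNIV"
proof -
  have "(\<lambda>n. c * (real_of_int \<bar>n\<bar> ^ k * r ^ nat \<bar>n\<bar>)) summable_on UNIV"
    by (intro summable_on_cmult_right summable_on_int_poly_geometric assms)
  then have "(\<lambda>n. norm (f n)) summable_on UNIV"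
    by (rule Infinite_Sum.abs_summable_on_comparison_test') (use b in auto)
  then have "f summable_on UNIV"
    by (rule summable_on_iff_abs_summable_on_real[THEN iffD2])
  then show ?thesis by (rule has_sum_infsum)
qed

lemma has_sum_zeta:
  assumes Q: "0 < Q" "Q < x" "x < 1"
  shows "((\<lambda>n. of_int n ^ k * kern Q n * x powi n) has_sum zeta k Q x) UNIV"
  unfolding zeta_def
proof (rule has_sum_by_geometric_bound[of "max x (Q / x)" _ "1 / (1 - Q)" k])
  fix n :: int
  have x: "0 < x" using Q by simp
  have "\<bar>of_int n ^ k * kern Q n * x powi n\<bar> = of_int \<bar>n\<bar> ^ k * (\<bar>kern Q n\<bar> * x powi n)"
    using x by (simp add: abs_mult power_abs)
  also have "\<dots> \<le> of_int \<bar>n\<bar> ^ k * (Q ^ nat (- n) / (1 - Q) * x powi n)"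
    using x kern_bound[of Q n] Q by (intro mult_left_mono mult_right_mono) auto
  also have "\<dots> = 1 / (1 - Q) * (of_int \<bar>n\<bar> ^ k * (Q ^ nat (- n) * x powi n))" by simp
  also have "\<dots> \<le> 1 / (1 - Q) * (of_int \<bar>n\<bar> ^ k * max x (Q / x) ^ nat \<bar>n\<bar>)"
    using annulus_bound[OF Q] Q by (intro mult_left_mono) auto
  finally show "\<bar>of_int n ^ k * kern Q n * x powi n\<bar> \<le>
    1 / (1 - Q) * (of_int \<bar>n\<bar> ^ k * max x (Q / x) ^ nat \<bar>n\<bar>)" .
qed (use annulus_bound[OF Q] in auto)

lemma has_sum_xi:
  assumes Q: "0 < Q" "Q < x" "x < 1"
  shows "((\<lambda>n. of_int n ^ k * dkern Q n * x powi n) has_sum xi k Q x) UNIV"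
  unfolding xi_def
proof (rule has_sum_by_geometric_bound[of "max x (Q / x)" _ "1 / (1 - Q)\<^sup>2" k])
  fix n :: int
  have x: "0 < x" using Q by simp
  have "\<bar>of_int n ^ k * dkern Q n * x powi n\<bar> = of_int \<bar>n\<bar> ^ k * (\<bar>dkern Q n\<bar> * x powi n)"
    using x by (simp add: abs_mult power_abs)
  also have "\<dots> \<le> of_int \<bar>n\<bar> ^ k * (Q ^ nat \<bar>n\<bar> / (1 - Q)\<^sup>2 * x powi n)"
    using x dkern_bound[of Q n] Q by (intro mult_left_mono mult_right_mono) auto
  also have "\<dots> = 1 / (1 - Q)\<^sup>2 * (of_int \<bar>n\<bar> ^ k * (Q ^ nat \<bar>n\<bar> * x powi n))" by simp
  also have "\<dots> \<le> 1 / (1 - Q)\<^sup>2 * (of_int \<bar>n\<bar> ^ k * max x (Q / x) ^ nat \<bar>n\<bar>)"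
    using annulus_bound[OF Q] Q by (intro mult_left_mono) auto
  finally show "\<bar>of_int n ^ k * dkern Q n * x powi n\<bar> \<le>
    1 / (1 - Q)\<^sup>2 * (of_int \<bar>n\<bar> ^ k * max x (Q / x) ^ nat \<bar>n\<bar>)" .
qed (use annulus_bound[OF Q] in auto)

lemma has_sum_dkern:
  assumes Q: "0 < Q" "Q < 1"
  shows "(dkern Q has_sum infsum (dkern Q) UNIV) UNIV"
  using dkern_bound[OF Q] Q
  by (intro has_sum_by_geometric_bound[of Q _ "1 / (1 - Q)\<^sup>2" 0]) auto

lemma has_sum_finite_sum:
  fixes f :: "'a \<Rightarrow> 'b \<Rightarrow> real"
  assumes "finite I" "\<And>l. l \<in> I \<Longrightarrow> (f l has_sum S l) A"
  shows "((\<lambda>z. \<Sum>l\<in>I. f l z) has_sum (\<Sum>l\<in>I. S l)) A"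
  using assms
proof (induction I rule: finite_induct)
  case (insert l I)
  then have "((\<lambda>z. f l z + (\<Sum>l\<in>I. f l z)) has_sum (S l + (\<Sum>l\<in>I. S l))) A"
    by (intro has_sum_add) auto
  then show ?case using insert.hyps by simp
qed simp

text \<open>
With \<open>y = x z\<close>, the powers \<open>(k + n)^i\<close> and \<open>n^j\<close> appear when \<open>(x d/dx)^i (z d/dz)^j\<close> is applied to
\<open>\<zeta>(x) \<zeta>(x z)\<close>, and the right-hand side is Leibniz' rule for this.
\<close>
lemma has_sum_shifted_product:
  assumes Q: "0 < Q" "Q < x" "x < 1" "Q < y" "y < 1"
  shows "((\<lambda>(k, n). of_int (k + n) ^ i * of_int n ^ j * (kern Q k * kern Q n) * (x powi k * y powi n))
    has_sum (\<Sum>l\<le>i. real (i choose l) * zeta l Q x * zeta (i - l + j) Q y)) (UNIV \<times> UNIV)"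
proof -
  let ?t = "\<lambda>l k n. real (i choose l) * ((of_int k ^ l * kern Q k * x powi k) *
    (of_int n ^ (i - l) * of_int n ^ j * kern Q n * y powi n))"
  have "((\<lambda>(k, n). ?t l k n) has_sum real (i choose l) * (zeta l Q x * zeta (i - l + j) Q y)) (UNIV \<times> UNIV)" for l
    using has_sum_cmult_right[OF has_sum_times_real[OF has_sum_zeta[OF Q(1-3), of l]
        has_sum_zeta[OF Q(1,4,5), of "i - l + j"]], of "real (i choose l)"]
    by (simp only: case_prod_unfold power_add)
  then have "((\<lambda>z. \<Sum>l\<le>i. (case z of (k, n) \<Rightarrow> ?t l k n)) has_sum
     (\<Sum>l\<le>i. real (i choose l) * (zeta l Q x * zeta (i - l + j) Q y))) (UNIV \<times> UNIV)"
    by (intro has_sum_finite_sum finite_atMost)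
  moreover have "(\<Sum>l\<le>i. (case z of (k, n) \<Rightarrow> ?t l k n)) = (case z of (k, n) \<Rightarrow>
     of_int (k + n) ^ i * of_int n ^ j * (kern Q k * kern Q n) * (x powi k * y powi n))" for z
    unfolding case_prod_unfold of_int_add binomial_ring sum_distrib_right
    by (intro sum.cong) (auto simp: power_add algebra_simps)
  ultimately show ?thesis by (simp add: mult.assoc)
qed

text \<open>
The result of applying \<open>(x d/dx)^i (y d/dy)^j\<close> to the addition theorem for \<open>\<zeta>(x)\<close>, \<open>\<zeta>(y)\<close>, \<open>\<zeta>(x y)\<close>. The
coefficients of \<open>x^m y^n\<close> in the three products cancel by \<open>kern_three_term\<close> except on the lines \<open>m = n\<close>,
\<open>m = 0\<close> and \<open>n = 0\<close>. What remains there is a Laurent series in \<open>x y\<close>, in \<open>y\<close> or in \<open>x\<close> alone with coefficients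
\<open>dkern\<close>, corrected at the origin.
\<close>
lemma three_term_identity:
  assumes Q: "0 < Q" "Q < x" "x < 1" "Q < y" "y < 1" "Q < x * y"
  shows "zeta i Q x * zeta j Q y
      - (\<Sum>l\<le>i. real (i choose l) * zeta l Q x * zeta (i - l + j) Q (x * y))
      - (\<Sum>l\<le>j. real (j choose l) * zeta l Q y * zeta (j - l + i) Q (x * y))
    = xi (i + j) Q (x * y) + 0 ^ i * xi j Q y + 0 ^ j * xi i Q x - 0 ^ i * 0 ^ j / 4"
    (is "?A - ?B - ?C = ?R")
proof -
  have xy: "x * y < 1" using Q by (smt (verit) mult_less_cancel_left2 mult_pos_pos)
  have Q1: "Q < 1" and x: "x \<noteq> 0" "y \<noteq> 0" using Q by auto
  let ?w = "\<lambda>m n. of_int m ^ i * of_int n ^ j * (x powi m * y powi n)"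
  have A: "((\<lambda>(m, n). ?w m n * (kern Q m * kern Q n)) has_sum ?A) (UNIV \<times> UNIV)"
    using has_sum_times_real[OF has_sum_zeta[OF Q(1-3)] has_sum_zeta[OF Q(1,4,5)]]
    by (simp add: mult_ac)
  have B: "((\<lambda>(m, n). ?w m n * (kern Q (m - n) * kern Q n)) has_sum ?B) (UNIV \<times> UNIV)"
    by (rule has_sum_reindex_bij_witness[of _ "\<lambda>(m, n). (m - n, n)" "\<lambda>(k, n). (k + n, n)", THEN iffD1,
          OF _ _ _ _ _ _ has_sum_shifted_product[OF Q(1-3,6) xy]])
      (use x in \<open>auto simp: power_int_add power_int_mult_distrib mult_ac\<close>)
  have C: "((\<lambda>(m, n). ?w m n * (kern Q (n - m) * kern Q m)) has_sum ?C) (UNIV \<times> UNIV)"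
    by (rule has_sum_reindex_bij_witness[of _ "\<lambda>(m, n). (n - m, m)" "\<lambda>(k, m). (m, k + m)", THEN iffD1,
          OF _ _ _ _ _ _ has_sum_shifted_product[OF Q(1,4,5,6) xy]])
      (use x in \<open>auto simp: power_int_add power_int_mult_distrib mult_ac\<close>)
  have d1: "((\<lambda>(m, n). if m = n then of_int n ^ (i + j) * dkern Q n * (x * y) powi n else 0)
      has_sum xi (i + j) Q (x * y)) (UNIV \<times> UNIV)"
  proof -
    have "((\<lambda>(m, n). if m = n then of_int n ^ (i + j) * dkern Q n * (x * y) powi n else 0)
        has_sum xi (i + j) Q (x * y)) (range (\<lambda>n. (n, n)))"
      by (subst has_sum_reindex) (auto simp: inj_on_def o_def intro!: has_sum_zeta has_sum_xi Q xy)
    then show ?thesis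
      by (rule has_sum_cong_neutral[THEN iffD1, rotated -1]) auto
  qed
  have d2: "((\<lambda>(m::int, n). if m = 0 then 0 ^ i * (of_int n ^ j * dkern Q n * y powi n) else 0)
      has_sum 0 ^ i * xi j Q y) (UNIV \<times> UNIV)"
  proof -
    have "((\<lambda>(m::int, n). if m = 0 then 0 ^ i * (of_int n ^ j * dkern Q n * y powi n) else 0)
        has_sum 0 ^ i * xi j Q y) (range (\<lambda>n. (0, n)))"
      by (subst has_sum_reindex) (auto simp: inj_on_def o_def intro!: has_sum_cmult_right has_sum_xi Q)
    then show ?thesis
      by (rule has_sum_cong_neutral[THEN iffD1, rotated -1]) auto
  qed
  have d3: "((\<lambda>(m, n::int). if n = 0 then 0 ^ j * (of_int m ^ i * dkern Q m * x powi m) else 0)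
      has_sum 0 ^ j * xi i Q x) (UNIV \<times> UNIV)"
  proof -
    have "((\<lambda>(m, n::int). if n = 0 then 0 ^ j * (of_int m ^ i * dkern Q m * x powi m) else 0)
        has_sum 0 ^ j * xi i Q x) (range (\<lambda>m. (m, 0)))"
      by (subst has_sum_reindex) (auto simp: inj_on_def o_def intro!: has_sum_cmult_right has_sum_xi Q)
    then show ?thesis
      by (rule has_sum_cong_neutral[THEN iffD1, rotated -1]) auto
  qed
  have d4: "((\<lambda>(m::int, n::int). if m = 0 \<and> n = 0 then 0 ^ i * 0 ^ j / 4 else 0 :: real)
      has_sum 0 ^ i * 0 ^ j / 4) (UNIV \<times> UNIV)"
    by (rule has_sum_finite_neutralI[of "{(0, 0)}"]) (auto split: if_splits)
  have coeff: "?w m n * (kern Q m * kern Q n) - ?w m n * (kern Q (m - n) * kern Q n)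
      - ?w m n * (kern Q (n - m) * kern Q m)
    = (if m = n then of_int n ^ (i + j) * dkern Q n * (x * y) powi n else 0)
      + (if m = 0 then 0 ^ i * (of_int n ^ j * dkern Q n * y powi n) else 0)
      + (if n = 0 then 0 ^ j * (of_int m ^ i * dkern Q m * x powi m) else 0)
      - (if m = 0 \<and> n = 0 then 0 ^ i * 0 ^ j / 4 else 0)" (is "?l = ?r") for m n
  proof -
    have l: "?l = ?w m n * (kern Q m * kern Q n - kern Q (m - n) * kern Q n - kern Q (n - m) * kern Q m)"
      by (simp add: algebra_simps)
    consider "m \<noteq> 0" "n \<noteq> 0" "m \<noteq> n" | "m = n" "n \<noteq> 0" | "m = 0" "n \<noteq> 0" | "n = 0" "m \<noteq> 0" | "m = 0" "n = 0"
      by blast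
    then show ?thesis
    proof cases
      case 1
      then show ?thesis unfolding l kern_three_term[OF Q(1) Q1 1] by simp
    next
      case 2
      have "kern Q 0 = 1 / 2" by (simp add: kern_def)
      then show ?thesis unfolding l using 2
        by (simp add: dkern_eq[OF Q(1) Q1] power_int_mult_distrib power_add power2_eq_square)
    next
      case 3
      have "kern Q 0 = 1 / 2" by (simp add: kern_def)
      then show ?thesis unfolding l using 3
        by (simp add: dkern_eq[OF Q(1) Q1] kern_minus[OF Q(1) Q1] power2_eq_square algebra_simps)
    next
      case 4
      have "kern Q 0 = 1 / 2" by (simp add: kern_def)
      then show ?thesis unfolding l using 4
        by (simp add: dkern_eq[OF Q(1) Q1] kern_minus[OF Q(1) Q1] power2_eq_square algebra_simps)
    next
      case 5
      then show ?thesis unfolding l by (simp add: kern_def dkern_def)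
    qed
  qed
  have "((\<lambda>(m, n). ?w m n * (kern Q m * kern Q n) - ?w m n * (kern Q (m - n) * kern Q n)
      - ?w m n * (kern Q (n - m) * kern Q m)) has_sum (?A - ?B - ?C)) (UNIV \<times> UNIV)"
    using has_sum_diff_real[OF has_sum_diff_real[OF A B] C] by (simp add: case_prod_unfold)
  moreover have "((\<lambda>(m, n). ?w m n * (kern Q m * kern Q n) - ?w m n * (kern Q (m - n) * kern Q n)
      - ?w m n * (kern Q (n - m) * kern Q m)) has_sum ?R) (UNIV \<times> UNIV)"
    unfolding coeff
    using has_sum_diff_real[OF has_sum_add[OF has_sum_add[OF d1 d2] d3] d4] by (simp add: case_prod_unfold)
  ultimately show ?thesis by (rule has_sum_unique)
qed

section \<open>The heat equation and reflection\<close>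

text \<open>
A telescoping sum: \<open>kern Q m\<close> tends to 0 for \<open>m \<rightarrow> -\<infinity>\<close> and to 1 for \<open>m \<rightarrow> \<infinity>\<close>.
\<close>
lemma kern_minus_step_has_sum:
  assumes Q: "0 < Q" "Q < (1::real)"
  shows "((\<lambda>m. kern Q m - kern Q (m - N)) has_sum of_int N) UNIV"
proof -
  \<comment> \<open>The step function is removed. The rest is summable, so shifting it does not change its sum.\<close>
  define r where "r m = kern Q m - (if m > 0 then 1 else 0)" for m :: int
  have kb: "\<bar>r m\<bar> \<le> 1 / (1 - Q) * (of_int \<bar>m\<bar> ^ 0 * Q ^ nat \<bar>m\<bar>)" for m
  proof (cases "m > 0")
    case True
    have "r m = - kern Q (- m)" using True kern_minus[OF Q, of m] by (simp add: r_def)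
    then show ?thesis using kern_bound[OF Q, of "- m"] True by simp
  next
    case False
    then show ?thesis using kern_bound[OF Q, of m] by (simp add: r_def)
  qed
  have r: "(r has_sum infsum r UNIV) UNIV"
    by (rule has_sum_by_geometric_bound[OF Q kb])
  have r': "((\<lambda>m. r (m - N)) has_sum infsum r UNIV) UNIV"
    by (rule has_sum_reindex_bij_witness[of _ "\<lambda>m. m + N" "\<lambda>m. m - N", THEN iffD2, OF _ _ _ _ _ _ r]) auto
  have step: "((\<lambda>m. (if m > 0 then 1 else 0) - (if m > N then 1 else 0)) has_sum real_of_int N) UNIV"
  proof (cases "N \<ge> 0")
    case True
    then show ?thesis
      by (intro has_sum_finite_neutralI[of "{0<..N}"]) (auto simp: sum.If_cases split: if_splits)
  next
    case False
    have "(\<Sum>m\<in>{N<..0}. (if m > 0 then 1 else 0) - (if m > N then 1 else 0)) = (\<Sum>m\<in>{N<..0}. - 1 :: real)"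
      by (intro sum.cong) auto
    then show ?thesis using False
      by (intro has_sum_finite_neutralI[of "{N<..0}"]) (auto split: if_splits)
  qed
  have "((\<lambda>m. (r m - r (m - N)) + ((if m > 0 then 1 else 0) - (if m > N then 1 else 0)))
      has_sum (infsum r UNIV - infsum r UNIV + of_int N)) UNIV"
    by (intro has_sum_add has_sum_diff_real r r' step)
  then show ?thesis by (simp add: r_def)
qed

text \<open>
For \<open>N \<noteq> 0\<close>, by partial fractions, \<open>kern Q m * kern Q (N - m)\<close> is \<open>kern Q N\<close> times the difference of \<open>kern Q m\<close> and
\<open>kern Q (m - N)\<close>, up to corrections at \<open>m = 0\<close> and \<open>m = N\<close>; so the sum telescopes.
\<close>
lemma kern_convolution:
  assumes Q: "0 < Q" "Q < (1::real)"
  shows "((\<lambda>m. kern Q m * kern Q (N - m)) has_sum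
    (if N = 0 then 1 / 4 - infsum (dkern Q) UNIV else of_int N * kern Q N - 2 * dkern Q N)) UNIV"
proof (cases "N = 0")
  case True
  have "kern Q m * kern Q (- m) = (if m = 0 then 1 / 4 else 0) - dkern Q m" for m
  proof (cases "m = 0")
    case False
    then show ?thesis by (simp add: kern_minus[OF Q] dkern_eq[OF Q] power2_eq_square algebra_simps)
  qed (simp add: kern_def dkern_def)
  moreover have "((\<lambda>m. (if m = 0 then 1 / 4 else 0) - dkern Q m) has_sum 1 / 4 - infsum (dkern Q) UNIV) UNIV"
    by (intro has_sum_diff_real has_sum_dkern Q has_sum_finite_neutralI[of "{0}"]) (auto split: if_splits)
  ultimately show ?thesis using True by simp
next
  case False
  define c where "c = kern Q N - 2 * kern Q N * (kern Q N - 1 / 2)"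
  have k0: "kern Q 0 = 1 / 2" by (simp add: kern_def)
  have "kern Q m * kern Q (N - m) = kern Q N * (kern Q m - kern Q (m - N))
      + ((if m = 0 then c / 2 else 0) + (if m = N then c / 2 else 0))" for m
  proof -
    consider "m = 0" | "m = N" | "m \<noteq> 0" "m \<noteq> N" by blast
    then show ?thesis
    proof cases
      case 1
      then show ?thesis using False
        by (simp add: c_def k0 kern_minus[OF Q] field_simps power2_eq_square)
    next
      case 2
      then show ?thesis using False
        by (simp add: c_def k0 kern_minus[OF Q] field_simps power2_eq_square)
    next
      case 3
      have "kern Q (m - N) = 1 - kern Q (N - m)" using kern_minus[OF Q, of "N - m"] by simp
      then show ?thesis using 3 kern_three_term[OF Q, of N m] False kern_minus[OF Q, of "N - m"]
        by (simp add: algebra_simps)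
    qed
  qed
  moreover have "((\<lambda>m. kern Q N * (kern Q m - kern Q (m - N))
      + ((if m = 0 then c / 2 else 0) + (if m = N then c / 2 else 0)))
      has_sum kern Q N * of_int N + (c / 2 + c / 2)) UNIV"
    by (intro has_sum_add has_sum_cmult_right kern_minus_step_has_sum Q
        has_sum_finite_neutralI[of "{0}"] has_sum_finite_neutralI[of "{N}"]) (auto split: if_splits)
  moreover have "kern Q N * of_int N + (c / 2 + c / 2) = of_int N * kern Q N - 2 * dkern Q N"
    by (simp add: c_def dkern_eq[OF Q False] power2_eq_square algebra_simps)
  ultimately show ?thesis using False by (simp add: mult.commute)
qed

text \<open>
The theta function \<open>\<vartheta>\<close> satisfies a heat equation. In terms of the logarithmic derivative \<open>\<zeta>\<close> it says that
\<open>\<zeta>^2 - x d\<zeta>/dx\<close> is a constant multiple of the logarithmic derivative of \<open>\<vartheta>\<close> with respect to \<open>Q\<close>,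
and up to an additive constant this is \<open>- 2 xi 0\<close>. Here \<open>x d/dx\<close> has been applied \<open>k\<close> times to that equation.
\<close>
lemma heat_identity:
  assumes Q: "0 < Q" "Q < x" "x < 1"
  shows "(\<Sum>l\<le>k. real (k choose l) * zeta l Q x * zeta (k - l) Q x)
    = zeta (k + 1) Q x - 2 * xi k Q x + 0 ^ k * (1 / 4 - infsum (dkern Q) UNIV)"
proof -
  have Q1: "Q < 1" and x: "x \<noteq> 0" using Q by auto
  let ?c = "1 / 4 - infsum (dkern Q) UNIV"
  have "((\<lambda>(m, n). of_int (m + n) ^ k * (kern Q m * kern Q n) * (x powi m * x powi n))
    has_sum (\<Sum>l\<le>k. real (k choose l) * zeta l Q x * zeta (k - l) Q x)) (UNIV \<times> UNIV)"
    using has_sum_shifted_product[OF Q Q(2,3), of k 0] by simp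
  then have "((\<lambda>(N, m). of_int N ^ k * x powi N * (kern Q m * kern Q (N - m)))
    has_sum (\<Sum>l\<le>k. real (k choose l) * zeta l Q x * zeta (k - l) Q x)) (UNIV \<times> UNIV)"
    by (rule has_sum_reindex_bij_witness[of _ "\<lambda>(N, m). (m, N - m)" "\<lambda>(m, n). (m + n, m)", THEN iffD1,
          rotated -1]) (use x in \<open>auto simp: power_int_add mult_ac\<close>)
  then have h1: "((\<lambda>N. of_int N ^ k * x powi N * (if N = 0 then ?c else of_int N * kern Q N - 2 * dkern Q N))
    has_sum (\<Sum>l\<le>k. real (k choose l) * zeta l Q x * zeta (k - l) Q x)) UNIV"
  proof (rule has_sum_SigmaD)
    fix N :: int
    show "((\<lambda>m. case (N, m) of (N, m) \<Rightarrow> of_int N ^ k * x powi N * (kern Q m * kern Q (N - m))) has_sum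
       of_int N ^ k * x powi N * (if N = 0 then ?c else of_int N * kern Q N - 2 * dkern Q N)) UNIV"
      unfolding prod.case by (intro has_sum_cmult_right kern_convolution Q(1) Q1)
  qed
  have h2: "((\<lambda>N. of_int N ^ (k + 1) * kern Q N * x powi N - 2 * (of_int N ^ k * dkern Q N * x powi N)
      + (if N = 0 then 0 ^ k * ?c else 0)) has_sum
      (zeta (k + 1) Q x - 2 * xi k Q x + 0 ^ k * ?c)) UNIV"
    by (intro has_sum_add has_sum_diff_real has_sum_cmult_right has_sum_zeta has_sum_xi Q
        has_sum_finite_neutralI[of "{0}"]) (auto split: if_splits)
  have eq: "(\<lambda>N. of_int N ^ (k + 1) * kern Q N * x powi N - 2 * (of_int N ^ k * dkern Q N * x powi N)
      + (if N = 0 then 0 ^ k * ?c else 0)) = (\<lambda>N. of_int N ^ k * x powi N * (if N = 0 then ?c else of_int N * kern Q N - 2 * dkern Q N))"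
    by (rule ext) (auto simp: dkern_def algebra_simps)
  show ?thesis by (rule has_sum_unique[OF h1 h2[unfolded eq]])
qed

text \<open>
Oddness under \<open>x \<mapsto> 1 / x\<close> combined with quasi-periodicity under \<open>x \<mapsto> Q x\<close>. The composition maps the annulus
\<open>Q < x < 1\<close> to itself.
\<close>
lemma zeta_reflect:
  assumes Q: "0 < Q" "Q < x" "x < 1"
  shows "zeta k Q (Q / x) = 0 ^ k - (- 1) ^ k * zeta k Q x"
proof -
  have x: "0 < x" and Q1: "Q < 1" using Q by auto
  have Qx: "Q < Q / x" "Q / x < 1" using Q x by (auto simp: field_simps)
  have "((\<lambda>n. of_int (- n) ^ k * kern Q (- n) * (Q / x) powi (- n)) has_sum zeta k Q (Q / x)) UNIV"
    by (rule has_sum_reindex_bij_witness[of _ uminus uminus, THEN iffD1, OF _ _ _ _ _ _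
          has_sum_zeta[OF Q(1) Qx]]) auto
  moreover have "((\<lambda>n. (if n = 0 then 0 ^ k else 0) - (- 1) ^ k * (of_int n ^ k * kern Q n * x powi n))
    has_sum (0 ^ k - (- 1) ^ k * zeta k Q x)) (UNIV::int set)"
    by (intro has_sum_diff_real has_sum_cmult_right has_sum_zeta Q has_sum_finite_neutralI[of "{0}"])
      (auto split: if_splits)
  moreover have "of_int (- n) ^ k * kern Q (- n) * (Q / x) powi (- n)
    = (if n = 0 then 0 ^ k else 0) - (- 1) ^ k * (of_int n ^ k * kern Q n * x powi n)" for n
  proof (cases "n = 0")
    case False
    have "1 - Q powi n \<noteq> 0" using powi_neq_1[OF Q(1) Q1 False] by simp
    then have "(1 - kern Q n) * (Q / x) powi (- n) = - (kern Q n * x powi n)"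
      using False Q x by (simp add: kern_def power_int_minus power_int_divide_distrib divide_simps)
    then have "(1 - kern Q n) * (Q / x) powi (- n) * of_int (- n) ^ k = - (kern Q n * x powi n) * of_int (- n) ^ k"
      by simp
    moreover have "of_int (- n) ^ k = (- 1) ^ k * real_of_int n ^ k"
      by (simp add: power_minus[of "real_of_int n"])
    ultimately show ?thesis using False by (simp add: kern_minus[OF Q(1) Q1] mult_ac)
  qed (auto simp: kern_def power_0_left)
  ultimately show ?thesis using has_sum_unique by simp
qed

lemma xi_reflect:
  assumes Q: "0 < Q" "Q < x" "x < 1"
  shows "xi k Q (Q / x) = (- 1) ^ k * (xi k Q x + zeta k Q x) - 0 ^ k / 2"
proof -
  have x: "0 < x" and Q1: "Q < 1" using Q by auto
  have Qx: "Q < Q / x" "Q / x < 1" using Q x by (auto simp: field_simps)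
  have "((\<lambda>n. of_int (- n) ^ k * dkern Q (- n) * (Q / x) powi (- n)) has_sum xi k Q (Q / x)) UNIV"
    by (rule has_sum_reindex_bij_witness[of _ uminus uminus, THEN iffD1, OF _ _ _ _ _ _
          has_sum_xi[OF Q(1) Qx]]) auto
  moreover have "((\<lambda>n. (- 1) ^ k * (of_int n ^ k * dkern Q n * x powi n + of_int n ^ k * kern Q n * x powi n)
      - (if n = 0 then 0 ^ k / 2 else 0))
    has_sum ((- 1) ^ k * (xi k Q x + zeta k Q x) - 0 ^ k / 2)) (UNIV::int set)"
    by (intro has_sum_diff_real has_sum_add has_sum_cmult_right has_sum_zeta has_sum_xi Q
        has_sum_finite_neutralI[of "{0}"])
      (auto split: if_splits)
  moreover have "of_int (- n) ^ k * dkern Q (- n) * (Q / x) powi (- n)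
    = (- 1) ^ k * (of_int n ^ k * dkern Q n * x powi n + of_int n ^ k * kern Q n * x powi n)
      - (if n = 0 then 0 ^ k / 2 else 0)" for n
  proof (cases "n = 0")
    case False
    have "1 - Q powi n \<noteq> 0" using powi_neq_1[OF Q(1) Q1 False] by simp
    then have "dkern Q n * (Q / x) powi (- n) = (dkern Q n + kern Q n) * x powi n"
      using False Q x by (simp add: kern_def dkern_def power_int_minus power_int_divide_distrib divide_simps)
        (simp add: power2_eq_square algebra_simps)
    then have "dkern Q n * (Q / x) powi (- n) * of_int (- n) ^ k = (dkern Q n + kern Q n) * x powi n * of_int (- n) ^ k"
      by simp
    moreover have "of_int (- n) ^ k = (- 1) ^ k * real_of_int n ^ k"
      by (simp add: power_minus[of "real_of_int n"])
    ultimately show ?thesis using False by (simp add: dkern_minus[OF Q(1) Q1] algebra_simps)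
  qed (auto simp: kern_def dkern_def power_0_left)
  ultimately show ?thesis using has_sum_unique by simp
qed

section \<open>Values at a point of order three\<close>

text \<open>
Modulo powers of \<open>Q = q^3\<close> the point \<open>x = q\<close> has order three. Therefore \<open>x^2 = Q / x\<close>, and all values at
\<open>x^2\<close> that occur in the addition theorem for \<open>y = x\<close> are values at \<open>x\<close> again, by reflection.
\<close>

definition zeta3 :: "nat \<Rightarrow> real \<Rightarrow> real" where
  "zeta3 k q = zeta k (q ^ 3) q"

definition xi3 :: "nat \<Rightarrow> real \<Rightarrow> real" where
  "xi3 k q = xi k (q ^ 3) q"

context
  fixes q :: real
  assumes q: "0 < q" "q < 1"
begin

private abbreviation Z where "Z k \<equiv> zeta3 k q"
private abbreviation S where "S k \<equiv> xi3 k q"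

lemma annulus: "0 < q ^ 3" "q ^ 3 < q" "q < 1" "q ^ 3 < q * q" "q * q = q ^ 3 / q"
proof -
  have "q ^ 3 < q ^ 2" "q ^ 3 < q ^ 1" using q by (intro power_strict_decreasing; simp)+
  then show "0 < q ^ 3" "q ^ 3 < q" "q < 1" "q ^ 3 < q * q" "q * q = q ^ 3 / q"
    using q by (auto simp: power2_eq_square power3_eq_cube)
qed

lemma zeta_square_point: "zeta k (q ^ 3) (q * q) = 0 ^ k - (- 1) ^ k * Z k"
  unfolding zeta3_def annulus(5) by (rule zeta_reflect[OF annulus(1-3)])

lemma xi_square_point: "xi k (q ^ 3) (q * q) = (- 1) ^ k * (S k + Z k) - 0 ^ k / 2"
  unfolding zeta3_def xi3_def annulus(5) by (rule xi_reflect[OF annulus(1-3)])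

lemma three_term_at_torsion:
  "Z i * Z j - (\<Sum>l\<le>i. real (i choose l) * Z l * (0 ^ (i - l + j) - (- 1) ^ (i - l + j) * Z (i - l + j)))
      - (\<Sum>l\<le>j. real (j choose l) * Z l * (0 ^ (j - l + i) - (- 1) ^ (j - l + i) * Z (j - l + i)))
    = (- 1) ^ (i + j) * (S (i + j) + Z (i + j)) - 0 ^ (i + j) / 2
      + 0 ^ i * S j + 0 ^ j * S i - 0 ^ i * 0 ^ j / 4"
  using three_term_identity[OF annulus(1-3,2-4), of i j]
  unfolding zeta_square_point xi_square_point unfolding zeta3_def xi3_def .

lemma heat_at_torsion:
  "(\<Sum>l\<le>k. real (k choose l) * Z l * Z (k - l))
    = Z (k + 1) - 2 * S k + 0 ^ k * (1 / 4 - infsum (dkern (q ^ 3)) UNIV)"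
  using heat_identity[OF annulus(1-3), of k] unfolding zeta3_def xi3_def .

text \<open>
The addition theorem with \<open>(i, j)\<close> equal to \<open>(0, 0)\<close>, \<open>(1, 1)\<close>, \<open>(2, 1)\<close> and \<open>(2, 2)\<close>. The pairs with
\<open>i + j = 1\<close> give no information, so \<open>xi3 1\<close> has to come from the heat equation.
\<close>
lemma xi3_values:
  "S 0 = (Z 0 - 1 / 2)\<^sup>2"
  "S 2 = (2 * Z 0 - 1) * Z 2 - (Z 1)\<^sup>2"
  "S 3 = (2 * Z 0 - 1) * Z 3 - 3 * Z 1 * Z 2"
  "S 4 = (2 * Z 0 - 1) * Z 4 - 4 * Z 1 * Z 3 + 3 * (Z 2)\<^sup>2"
proof -
  show "S 0 = (Z 0 - 1 / 2)\<^sup>2"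
    using three_term_at_torsion[of 0 0] by (simp add: power2_eq_square field_simps)
  show "S 2 = (2 * Z 0 - 1) * Z 2 - (Z 1)\<^sup>2"
    using three_term_at_torsion[of 1 1] by (simp add: numeral_2_eq_2 algebra_simps)
  show "S 3 = (2 * Z 0 - 1) * Z 3 - 3 * Z 1 * Z 2"
    using three_term_at_torsion[of 2 1] by (simp add: numeral_eq_Suc algebra_simps)
  show "S 4 = (2 * Z 0 - 1) * Z 4 - 4 * Z 1 * Z 3 + 3 * (Z 2)\<^sup>2"
    using three_term_at_torsion[of 2 2] by (simp add: numeral_eq_Suc algebra_simps)
qed

lemma heat_values:
  "(Z 0)\<^sup>2 = Z 1 - 2 * S 0 + (1 / 4 - infsum (dkern (q ^ 3)) UNIV)"
  "2 * Z 0 * Z 1 = Z 2 - 2 * S 1"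
  "2 * Z 0 * Z 2 + 2 * (Z 1)\<^sup>2 = Z 3 - 2 * S 2"
  "2 * Z 0 * Z 3 + 6 * Z 1 * Z 2 = Z 4 - 2 * S 3"
  "2 * Z 0 * Z 4 + 8 * Z 1 * Z 3 + 6 * (Z 2)\<^sup>2 = Z 5 - 2 * S 4"
proof -
  show "(Z 0)\<^sup>2 = Z 1 - 2 * S 0 + (1 / 4 - infsum (dkern (q ^ 3)) UNIV)"
    using heat_at_torsion[of 0] by (simp add: power2_eq_square)
  show "2 * Z 0 * Z 1 = Z 2 - 2 * S 1"
    using heat_at_torsion[of 1] by (simp add: numeral_2_eq_2)
  show "2 * Z 0 * Z 2 + 2 * (Z 1)\<^sup>2 = Z 3 - 2 * S 2"
    using heat_at_torsion[of 2] by (simp add: numeral_eq_Suc)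
  show "2 * Z 0 * Z 3 + 6 * Z 1 * Z 2 = Z 4 - 2 * S 3"
    using heat_at_torsion[of 3] by (simp add: numeral_eq_Suc)
  show "2 * Z 0 * Z 4 + 8 * Z 1 * Z 3 + 6 * (Z 2)\<^sup>2 = Z 5 - 2 * S 4"
    using heat_at_torsion[of 4] by (simp add: numeral_eq_Suc)
qed

text \<open>
Here \<open>6 * zeta3 0 q - 2\<close> is the cubic theta function \<open>a(q)\<close> of the Borweins, and \<open>27 * zeta3 2 q\<close> is their \<open>c(q)^3\<close>.
The first four relations result from eliminating \<open>xi3\<close> between the addition theorem and the heat equation.
\<close>
lemma torsion_relations:
  "Z 3 = (6 * Z 0 - 2) * Z 2"
  "Z 4 = (6 * Z 0 - 2) * Z 3"
  "Z 5 = (6 * Z 0 - 2) * Z 4 + 12 * (Z 2)\<^sup>2"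
  "(6 * Z 0 - 2)\<^sup>2 = 12 * Z 1 + 1 - 12 * infsum (dkern (q ^ 3)) UNIV"
  "S 1 = Z 2 / 2 - Z 0 * Z 1"
proof -
  show "Z 3 = (6 * Z 0 - 2) * Z 2"
    using heat_values(3) unfolding xi3_values by (simp add: algebra_simps)
  show "Z 4 = (6 * Z 0 - 2) * Z 3"
    using heat_values(4) unfolding xi3_values by (simp add: algebra_simps)
  show "Z 5 = (6 * Z 0 - 2) * Z 4 + 12 * (Z 2)\<^sup>2"
    using heat_values(5) unfolding xi3_values by (simp add: algebra_simps)
  show "(6 * Z 0 - 2)\<^sup>2 = 12 * Z 1 + 1 - 12 * infsum (dkern (q ^ 3)) UNIV"
    using heat_values(1) unfolding xi3_values by (simp add: power2_eq_square algebra_simps)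
  show "S 1 = Z 2 / 2 - Z 0 * Z 1"
    using heat_values(2) by simp
qed

end

section \<open>Lambert series\<close>

text \<open>
The power series of the double sum of \<open>f d m * q^(d m)\<close> over \<open>d, m \<ge> 1\<close>. For \<open>N = 0\<close> the set of divisors is infinite,
so the constant coefficient is 0.
\<close>
definition lambert :: "(nat \<Rightarrow> nat \<Rightarrow> real) \<Rightarrow> real fps" where
  "lambert f = Abs_fps (\<lambda>N. \<Sum>d | d dvd N. f d (N div d))"

definition poly_bounded :: "(nat \<Rightarrow> nat \<Rightarrow> real) \<Rightarrow> bool" where
  "poly_bounded f \<longleftrightarrow> (\<exists>c k. \<forall>d\<ge>1. \<forall>m\<ge>1. \<bar>f d m\<bar> \<le> c * real (d * m) ^ k)"

lemma poly_boundedI: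
  assumes "\<And>d m. d \<ge> 1 \<Longrightarrow> m \<ge> 1 \<Longrightarrow> \<bar>f d m\<bar> \<le> c * real (d * m) ^ k"
  shows "poly_bounded f"
  unfolding poly_bounded_def using assms by blast

lemma divisor_sum_bound:
  assumes b: "\<And>d m. d \<ge> 1 \<Longrightarrow> m \<ge> 1 \<Longrightarrow> \<bar>f d m\<bar> \<le> c * real (d * m) ^ k"
  shows "(\<Sum>d | d dvd N. \<bar>f d (N div d)\<bar>) \<le> c * (real N ^ (k + 1))"
proof (cases "N = 0")
  case False
  have c: "c \<ge> 0" using b[of 1 1] by simp
  have "(\<Sum>d | d dvd N. \<bar>f d (N div d)\<bar>) \<le> (\<Sum>d | d dvd N. c * real N ^ k)"
  proof (rule sum_mono)
    fix d assume "d \<in> {d. d dvd N}"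
    then have "d \<ge> 1" "N div d \<ge> 1" "d * (N div d) = N"
      using False by (auto simp: Suc_le_eq div_greater_zero_iff dvd_imp_le intro!: Nat.gr0I)
    then show "\<bar>f d (N div d)\<bar> \<le> c * real N ^ k" using b[of d "N div d"] by simp
  qed
  also have "\<dots> = real (card {d. d dvd N}) * (c * real N ^ k)" by simp
  also have "\<dots> \<le> real N * (c * real N ^ k)"
  proof (rule mult_right_mono)
    have "{d. d dvd N} \<subseteq> {1..N}" using False by (auto simp: dvd_imp_le Suc_le_eq intro!: Nat.gr0I)
    then have "card {d. d dvd N} \<le> card {1..N}" by (intro card_mono) auto
    then show "real (card {d. d dvd N}) \<le> real N" by simp
  qed (use c in simp)
  finally show ?thesis by (simp add: mult_ac)
qed simp

lemma lambert_nth_bound: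
  assumes b: "\<And>d m. d \<ge> 1 \<Longrightarrow> m \<ge> 1 \<Longrightarrow> \<bar>f d m\<bar> \<le> c * real (d * m) ^ k"
  shows "\<bar>fps_nth (lambert f) N\<bar> \<le> c * (real N ^ (k + 1))"
  using order_trans[OF sum_abs divisor_sum_bound[of f c k N, OF b]] by (simp add: lambert_def)

lemma fps_conv_radius_ge_1I:
  fixes f :: "real fps"
  assumes "\<And>N. \<bar>fps_nth f N\<bar> \<le> c * real N ^ k"
  shows "fps_conv_radius f \<ge> 1"
  unfolding fps_conv_radius_def
proof (rule conv_radius_geI_ex)
  fix r :: real assume r: "0 < r" "ereal r < 1"
  then have r1: "r < 1" by simp
  have "summable (\<lambda>n. c * (real n ^ k * r ^ n))"
    by (intro summable_mult summable_poly_geometric r r1)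
  then have "summable (\<lambda>n. fps_nth f n * r ^ n)"
  proof (rule summable_comparison_test')
    fix n show "norm (fps_nth f n * r ^ n) \<le> c * (real n ^ k * r ^ n)"
      using mult_right_mono[OF assms[of n], of "r ^ n"] r by (simp add: abs_mult mult_ac)
  qed
  then show "\<exists>z. norm z = r \<and> summable (\<lambda>n. fps_nth f n * z ^ n)"
    using r by (intro exI[of _ r]) auto
qed

lemma lambert_conv_radius: "poly_bounded f \<Longrightarrow> fps_conv_radius (lambert f) \<ge> 1"
  unfolding poly_bounded_def
proof (elim exE)
  fix c k assume "\<forall>d\<ge>1. \<forall>m\<ge>1. \<bar>f d m\<bar> \<le> c * real (d * m) ^ k"
  then show ?thesis
    by (intro fps_conv_radius_ge_1I[of _ c "k + 1"] lambert_nth_bound) auto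
qed

lemma has_sum_lambert:
  assumes f: "poly_bounded f" and q: "0 < q" "q < 1"
  shows "((\<lambda>(d, m). f d m * q ^ (d * m)) has_sum eval_fps (lambert f) q) ({1..} \<times> {1..})"
proof -
  obtain c k where b: "\<bar>f d m\<bar> \<le> c * real (d * m) ^ k" if "d \<ge> 1" "m \<ge> 1" for d m
    using f unfolding poly_bounded_def by blast
  let ?S = "Sigma {1..} (\<lambda>N. {d::nat. d dvd N})"
  let ?g = "\<lambda>(N, d). f d (N div d) * q ^ N"
  have "(\<lambda>(N, d). \<bar>f d (N div d)\<bar> * q ^ N) summable_on ?S"
  proof (rule summable_on_SigmaI)
    fix N :: nat assume "N \<in> {1..}"
    then have "finite {d. d dvd N}" by simp
    then show "((\<lambda>d. case (N, d) of (N, d) \<Rightarrow> \<bar>f d (N div d)\<bar> * q ^ N) has_sum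
        (\<Sum>d | d dvd N. \<bar>f d (N div d)\<bar>) * q ^ N) {d. d dvd N}"
      by (intro has_sum_finiteI) (auto simp: sum_distrib_right)
  next
    have "summable (\<lambda>N. norm ((\<Sum>d | d dvd N. \<bar>f d (N div d)\<bar>) * q ^ N))"
    proof (rule summable_comparison_test'[of "\<lambda>N. c * (real N ^ (k + 1) * q ^ N)"])
      show "summable (\<lambda>N. c * (real N ^ (k + 1) * q ^ N))"
        by (intro summable_mult summable_poly_geometric q)
      show "norm (norm ((\<Sum>d | d dvd N. \<bar>f d (N div d)\<bar>) * q ^ N)) \<le> c * (real N ^ (k + 1) * q ^ N)" for N
        using mult_right_mono[OF divisor_sum_bound[of f c k N, OF b], of "q ^ N"] q
        by (simp add: abs_mult mult_ac sum_nonneg)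
    qed
    then have "(\<lambda>N. (\<Sum>d | d dvd N. \<bar>f d (N div d)\<bar>) * q ^ N) summable_on UNIV"
      by (rule norm_summable_imp_summable_on)
    then show "(\<lambda>N. (\<Sum>d | d dvd N. \<bar>f d (N div d)\<bar>) * q ^ N) summable_on {1..}"
      by (rule summable_on_subset_banach) auto
  qed (use q in auto)
  then have "(\<lambda>z. norm (?g z)) summable_on ?S"
    using q by (simp add: case_prod_unfold abs_mult)
  then have g: "?g summable_on ?S"
    by (rule summable_on_iff_abs_summable_on_real[THEN iffD2])
  have "ereal (norm q) < fps_conv_radius (lambert f)"
    using order_less_le_trans[OF _ lambert_conv_radius[OF f], of "ereal q"] q by simp
  then have "(\<lambda>N. fps_nth (lambert f) N * q ^ N) sums eval_fps (lambert f) q"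
    by (rule sums_eval_fps)
  moreover have "summable (\<lambda>N. norm (fps_nth (lambert f) N * q ^ N))"
  proof (rule summable_comparison_test'[of "\<lambda>N. c * (real N ^ (k + 1) * q ^ N)"])
    show "summable (\<lambda>N. c * (real N ^ (k + 1) * q ^ N))"
      by (intro summable_mult summable_poly_geometric q)
    show "norm (norm (fps_nth (lambert f) N * q ^ N)) \<le> c * (real N ^ (k + 1) * q ^ N)" for N
      using mult_right_mono[OF lambert_nth_bound[of f c k N, OF b], of "q ^ N"] q
      by (simp add: abs_mult mult_ac)
  qed
  ultimately have "((\<lambda>N. fps_nth (lambert f) N * q ^ N) has_sum eval_fps (lambert f) q) UNIV"
    by (intro norm_summable_imp_has_sum)
  then have L: "((\<lambda>N. fps_nth (lambert f) N * q ^ N) has_sum eval_fps (lambert f) q) {1..}"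
    by (rule has_sum_cong_neutral[THEN iffD1, rotated -1])
      (auto simp: lambert_def not_less_eq_eq)
  have "(?g has_sum eval_fps (lambert f) q) ?S"
  proof (rule has_sum_SigmaI[OF _ L g])
    fix N :: nat assume "N \<in> {1..}"
    then have "finite {d. d dvd N}" by simp
    then show "((\<lambda>d. case (N, d) of (N, d) \<Rightarrow> f d (N div d) * q ^ N) has_sum
        fps_nth (lambert f) N * q ^ N) {d. d dvd N}"
      by (intro has_sum_finiteI) (auto simp: sum_distrib_right lambert_def)
  qed
  then show ?thesis
    by (rule has_sum_reindex_bij_witness[of ?S "\<lambda>(d, m). (d * m, d)" "\<lambda>(N, d). (d, N div d)", THEN iffD1, rotated -1])
      (auto simp: Suc_le_eq div_greater_zero_iff dvd_imp_le intro!: Nat.gr0I)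
qed

text \<open>
The classical form of a Lambert series: the inner sum over \<open>m\<close>, a power series in \<open>q^d\<close>, is known in closed form.
\<close>
lemma has_sum_lambert_inner:
  assumes f: "poly_bounded f" and q: "0 < q" "q < 1"
    and inner: "\<And>d. d \<ge> 1 \<Longrightarrow> ((\<lambda>m. f d m * (q ^ d) ^ m) has_sum g d) {1..}"
  shows "(g has_sum eval_fps (lambert f) q) {1..}"
  by (rule has_sum_SigmaD[OF has_sum_lambert[OF f q]])
    (use inner in \<open>auto simp: power_mult\<close>)

lemma X_deriv_lambert:
  "fps_X * fps_deriv (lambert f) = lambert (\<lambda>d m. real (d * m) * f d m)"
proof (rule fps_ext)
  fix N
  show "fps_nth (fps_X * fps_deriv (lambert f)) N = fps_nth (lambert (\<lambda>d m. real (d * m) * f d m)) N"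
  proof (cases N)
    case (Suc M)
    have "real N * (\<Sum>d | d dvd N. f d (N div d)) = (\<Sum>d | d dvd N. real (d * (N div d)) * f d (N div d))"
      by (simp only: sum_distrib_left, intro sum.cong) auto
    then show ?thesis using Suc by (simp only: lambert_def fps_mult_fps_X_deriv_shift fps_nth_Abs_fps)
  qed (simp add: lambert_def)
qed

lemma has_sum_int_pair:
  fixes g :: "int \<Rightarrow> real"
  assumes g: "(g has_sum S) UNIV"
  shows "((\<lambda>d::nat. g (int d) + g (- int d)) has_sum S - g 0) {1..}"
proof -
  have s: "g summable_on A" for A
    using has_sum_imp_summable[OF g] by (rule summable_on_subset_banach) auto
  have p: "((\<lambda>d. g (int d)) has_sum infsum g {0<..}) {1..}"
    by (rule has_sum_reindex_bij_witness[of _ nat int, THEN iffD2, OF _ _ _ _ _ _ has_sum_infsum[OF s]]) auto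
  have n: "((\<lambda>d. g (- int d)) has_sum infsum g {..<0}) {1..}"
    by (rule has_sum_reindex_bij_witness[of _ "\<lambda>n. nat (- n)" "\<lambda>d. - int d", THEN iffD2, OF _ _ _ _ _ _ has_sum_infsum[OF s]]) auto
  have "(g has_sum infsum g {0<..} + infsum g {..<0}) ({0<..} \<union> {..<0})"
    by (intro has_sum_Un_disjoint has_sum_infsum s) auto
  then have "(g has_sum g 0 + (infsum g {0<..} + infsum g {..<0})) (insert 0 ({0<..} \<union> {..<0}))"
    by (intro has_sum_insert) auto
  moreover have "insert 0 ({0<..} \<union> {..<0}) = (UNIV :: int set)" by auto
  ultimately have "S = g 0 + (infsum g {0<..} + infsum g {..<0})"
    using has_sum_unique[OF g] by simp
  then show ?thesis using has_sum_add[OF p n] by simp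
qed

lemma has_sum_mod_3:
  fixes h :: "nat \<Rightarrow> real"
  assumes h1: "((\<lambda>j. h (3 * j + 1)) has_sum A) UNIV" and h2: "((\<lambda>j. h (3 * j + 2)) has_sum B) UNIV"
    and h0: "\<And>j. h (3 * j) = 0"
  shows "(h has_sum A + B) {1..}"
proof -
  have 1: "(h has_sum A) {m::nat. m mod 3 = 1}"
    by (rule has_sum_reindex_bij_witness[of _ "\<lambda>m. m div 3" "\<lambda>j. 3 * j + 1", THEN iffD1, OF _ _ _ _ _ _ h1])
      (auto, presburger+)
  have 2: "(h has_sum B) {m::nat. m mod 3 = 2}"
    by (rule has_sum_reindex_bij_witness[of _ "\<lambda>m. m div 3" "\<lambda>j. 3 * j + 2", THEN iffD1, OF _ _ _ _ _ _ h2])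
      (auto, presburger+)
  have "(h has_sum A + B) ({m::nat. m mod 3 = 1} \<union> {m::nat. m mod 3 = 2})"
    by (intro has_sum_Un_disjoint 1 2) auto
  then show ?thesis
  proof (rule has_sum_cong_neutral[THEN iffD1, rotated -1])
    fix m assume "m \<in> {1..} - ({m::nat. m mod 3 = 1} \<union> {m::nat. m mod 3 = 2})"
    then have "m mod 3 = 0" by auto
    then show "h m = 0" using h0[of "m div 3"] by (metis mult_div_mod_eq add_0_right)
  qed (auto intro!: Suc_leI Nat.gr0I)
qed

lemma has_sum_geometric_real:
  assumes "0 < y" "y < (1::real)"
  shows "((\<lambda>j. y ^ j) has_sum 1 / (1 - y)) UNIV" "((\<lambda>j. real j * y ^ j) has_sum y / (1 - y)\<^sup>2) UNIV"
proof -
  show "((\<lambda>j. y ^ j) has_sum 1 / (1 - y)) UNIV"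
    using assms geometric_sums[of y]
    by (intro norm_summable_imp_has_sum) (auto simp: norm_power summable_geometric)
  have "(\<lambda>n. y * (real (Suc n) * y ^ n)) sums (y * (1 / (1 - y)\<^sup>2))"
    using geometric_deriv_sums[of y] assms by (intro sums_mult) auto
  then have "(\<lambda>n. real (Suc n) * y ^ Suc n) sums (y / (1 - y)\<^sup>2)" by (simp add: mult_ac)
  then have "(\<lambda>j. real j * y ^ j) sums (y / (1 - y)\<^sup>2)" by (subst (asm) sums_Suc_iff) simp
  moreover have "summable (\<lambda>j. real j * y ^ j)" using summable_poly_geometric[OF assms, of 1] by simp
  ultimately show "((\<lambda>j. real j * y ^ j) has_sum y / (1 - y)\<^sup>2) UNIV"
    using assms by (intro norm_summable_imp_has_sum) (auto simp: abs_mult)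
qed

text \<open>
The terms \<open>n = d\<close> and \<open>n = - d\<close> of the Laurent series of \<open>zeta3 k\<close> are geometric series in \<open>q^d\<close> with the
exponents \<open>1, 4, 7, \<dots>\<close> and \<open>2, 5, 8, \<dots>\<close>. The sign for the latter comes from \<open>(- d)^k\<close> and from
\<open>kern Q (- d) = - Q^d / (1 - Q^d)\<close>.
\<close>
definition chi3 :: "nat \<Rightarrow> nat \<Rightarrow> real" where
  "chi3 k m = (if m mod 3 = 1 then 1 else if m mod 3 = 2 then (- 1) ^ (k + 1) else 0)"

definition zeta3_fps :: "nat \<Rightarrow> real fps" where
  "zeta3_fps k = lambert (\<lambda>d m. real d ^ k * chi3 k m)"

lemma chi3_le_1: "\<bar>chi3 k m\<bar> \<le> 1"
  by (simp add: chi3_def power_abs)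

lemma zeta3_poly_bounded:
  "poly_bounded (\<lambda>d m. real d ^ k * chi3 k m)"
  "poly_bounded (\<lambda>d m. real (d * m) * (real d ^ k * chi3 k m))"
proof -
  have *: "\<bar>real d ^ k * chi3 k m\<bar> \<le> real (d * m) ^ k" if "d \<ge> 1" "m \<ge> 1" for d m
  proof -
    have "\<bar>real d ^ k * chi3 k m\<bar> \<le> real d ^ k"
      using mult_left_mono[OF chi3_le_1, of "real d ^ k" k m] by (simp add: abs_mult)
    also have "\<dots> \<le> real (d * m) ^ k" using that by (intro power_mono) auto
    finally show ?thesis .
  qed
  then show "poly_bounded (\<lambda>d m. real d ^ k * chi3 k m)"
    by (intro poly_boundedI[of _ 1 k]) simp
  show "poly_bounded (\<lambda>d m. real (d * m) * (real d ^ k * chi3 k m))"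
  proof (rule poly_boundedI[of _ 1 "k + 1"])
    fix d m :: nat assume "d \<ge> 1" "m \<ge> 1"
    then show "\<bar>real (d * m) * (real d ^ k * chi3 k m)\<bar> \<le> 1 * real (d * m) ^ (k + 1)"
      using mult_left_mono[OF *[of d m], of "real (d * m)"] by (simp add: abs_mult)
  qed
qed

lemma zeta3_eq_eval_fps:
  assumes q: "0 < q" "q < 1"
  shows "zeta3 k q = 0 ^ k / 2 + eval_fps (zeta3_fps k) q"
proof -
  have Q1: "q ^ 3 < 1" using q by (simp add: power_less_one_iff)
  let ?g = "\<lambda>n::int. of_int n ^ k * kern (q ^ 3) n * q powi n"
  have "((\<lambda>d. ?g (int d) + ?g (- int d)) has_sum eval_fps (zeta3_fps k) q) {1..}"
    unfolding zeta3_fps_def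
  proof (rule has_sum_lambert_inner[OF zeta3_poly_bounded(1) q])
    fix d :: nat assume d: "d \<ge> 1"
    define x where "x = q ^ d"
    have x: "0 < x" "x < 1" using q d by (auto simp: x_def power_less_one_iff)
    have x3: "(x ^ j) ^ 3 = (x ^ 3) ^ j" for j by (simp add: mult.commute flip: power_mult)
    have y: "0 < x ^ 3" "x ^ 3 < 1" using x by (auto simp: power_less_one_iff)
    have "((\<lambda>m. chi3 k m * x ^ m) has_sum (x * (1 / (1 - x ^ 3)) + (- 1) ^ (k + 1) * x\<^sup>2 * (1 / (1 - x ^ 3)))) {1..}"
    proof (rule has_sum_mod_3)
      show "((\<lambda>j. chi3 k (3 * j + 1) * x ^ (3 * j + 1)) has_sum x * (1 / (1 - x ^ 3))) UNIV"
        using has_sum_cmult_right[OF has_sum_geometric_real(1)[OF y], of x]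
        by (simp add: chi3_def power_mult x3 mod_Suc)
      show "((\<lambda>j. chi3 k (3 * j + 2) * x ^ (3 * j + 2)) has_sum (- 1) ^ (k + 1) * x\<^sup>2 * (1 / (1 - x ^ 3))) UNIV"
        using has_sum_cmult_right[OF has_sum_geometric_real(1)[OF y], of "(- 1) ^ (k + 1) * x\<^sup>2"]
        by (simp add: chi3_def power_mult x3 power2_eq_square mult_ac mod_Suc)
    qed (simp add: chi3_def)
    then have "((\<lambda>m. real d ^ k * (chi3 k m * x ^ m)) has_sum
        real d ^ k * (x * (1 / (1 - x ^ 3)) + (- 1) ^ (k + 1) * x\<^sup>2 * (1 / (1 - x ^ 3)))) {1..}"
      by (rule has_sum_cmult_right)
    moreover have "?g (int d) = real d ^ k * (x * (1 / (1 - x ^ 3)))"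
    proof -
      have "(q ^ 3) powi int d = x ^ 3" by (simp add: x_def mult.commute flip: power_mult)
      then show ?thesis using d by (simp add: kern_def x_def)
    qed
    moreover have "?g (- int d) = real d ^ k * ((- 1) ^ (k + 1) * x\<^sup>2 * (1 / (1 - x ^ 3)))"
    proof -
      have "(q ^ 3) powi int d = x ^ 3" by (simp add: x_def mult.commute flip: power_mult)
      then have "kern (q ^ 3) (- int d) = 1 - 1 / (1 - x ^ 3)"
        using d q Q1 by (subst kern_minus) (auto simp: kern_def)
      also have "\<dots> = - (x ^ 3 / (1 - x ^ 3))" using y by (simp add: divide_simps)
      finally have "kern (q ^ 3) (- int d) * q powi (- int d) = - (x\<^sup>2 / (1 - x ^ 3))"
        using x by (simp add: power_int_minus power2_eq_square power3_eq_cube field_simps flip: x_def)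
      then have "of_int (- int d) ^ k * (kern (q ^ 3) (- int d) * q powi (- int d)) = (- real d) ^ k * - (x\<^sup>2 / (1 - x ^ 3))"
        by simp
      then show ?thesis by (simp add: mult_ac power_minus[of "real d"])
    qed
    ultimately show "((\<lambda>m. real d ^ k * chi3 k m * (q ^ d) ^ m) has_sum ?g (int d) + ?g (- int d)) {1..}"
      by (simp add: x_def algebra_simps)
  qed
  moreover have "((\<lambda>d. ?g (int d) + ?g (- int d)) has_sum zeta3 k q - ?g 0) {1..}"
    unfolding zeta3_def by (rule has_sum_int_pair[OF has_sum_zeta]) (use annulus[OF q] in auto)
  ultimately have "zeta3 k q - ?g 0 = eval_fps (zeta3_fps k) q" using has_sum_unique by blast
  then show ?thesis by (simp add: kern_def)
qed

text \<open>
Along \<open>(x, Q) = (q, q^3)\<close> the operator \<open>q d/dq\<close> acts as \<open>x d/dx + 3 Q d/dQ\<close>. The first summand raises \<open>k\<close> by 1,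
and the second one replaces \<open>kern Q n\<close> by \<open>3 n * dkern Q n\<close>.
\<close>
lemma X_deriv_zeta3:
  assumes q: "0 < q" "q < 1"
  shows "eval_fps (fps_X * fps_deriv (zeta3_fps k)) q = zeta3 (k + 1) q + 3 * xi3 (k + 1) q"
proof -
  have Q1: "q ^ 3 < 1" using q by (simp add: power_less_one_iff)
  let ?g = "\<lambda>n::int. of_int n ^ (k + 1) * kern (q ^ 3) n * q powi n + 3 * (of_int n ^ (k + 1) * dkern (q ^ 3) n * q powi n)"
  have "((\<lambda>d. ?g (int d) + ?g (- int d)) has_sum eval_fps (fps_X * fps_deriv (zeta3_fps k)) q) {1..}"
    unfolding zeta3_fps_def X_deriv_lambert
  proof (rule has_sum_lambert_inner[OF zeta3_poly_bounded(2) q])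
    fix d :: nat assume d: "d \<ge> 1"
    define x where "x = q ^ d"
    define y where "y = x ^ 3"
    have x: "0 < x" "x < 1" using q d by (auto simp: x_def power_less_one_iff)
    have x3: "(x ^ j) ^ 3 = (x ^ 3) ^ j" for j by (simp add: mult.commute flip: power_mult)
    have y: "0 < y" "y < 1" using x by (auto simp: y_def power_less_one_iff)
    have Qd: "(q ^ 3) powi int d = y" by (simp add: x_def y_def mult.commute flip: power_mult)
    have Qd': "(q ^ 3) ^ d = y" using Qd by simp
    note G = has_sum_geometric_real[OF y]
    have "((\<lambda>m. real m * chi3 k m * x ^ m) has_sum (x * (3 * (y / (1 - y)\<^sup>2) + 1 / (1 - y))
        + (- 1) ^ (k + 1) * x\<^sup>2 * (3 * (y / (1 - y)\<^sup>2) + 2 * (1 / (1 - y))))) {1..}"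
    proof (rule has_sum_mod_3)
      show "((\<lambda>j. real (3 * j + 1) * chi3 k (3 * j + 1) * x ^ (3 * j + 1)) has_sum
          x * (3 * (y / (1 - y)\<^sup>2) + 1 / (1 - y))) UNIV"
        using has_sum_cmult_right[OF has_sum_add[OF has_sum_cmult_right[OF G(2), of 3] G(1)], of x]
        by (simp add: chi3_def power_mult x3 mod_Suc y_def algebra_simps)
      show "((\<lambda>j. real (3 * j + 2) * chi3 k (3 * j + 2) * x ^ (3 * j + 2)) has_sum
          (- 1) ^ (k + 1) * x\<^sup>2 * (3 * (y / (1 - y)\<^sup>2) + 2 * (1 / (1 - y)))) UNIV"
        using has_sum_cmult_right[OF has_sum_add[OF has_sum_cmult_right[OF G(2), of 3]
              has_sum_cmult_right[OF G(1), of 2]], of "(- 1) ^ (k + 1) * x\<^sup>2"]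
        by (simp add: chi3_def power_mult x3 power2_eq_square mod_Suc y_def algebra_simps)
    qed (simp add: chi3_def)
    then have "((\<lambda>m. real d ^ (k + 1) * (real m * chi3 k m * x ^ m)) has_sum
        real d ^ (k + 1) * (x * (3 * (y / (1 - y)\<^sup>2) + 1 / (1 - y))
        + (- 1) ^ (k + 1) * x\<^sup>2 * (3 * (y / (1 - y)\<^sup>2) + 2 * (1 / (1 - y))))) {1..}"
      by (rule has_sum_cmult_right)
    moreover have "?g (int d) = real d ^ (k + 1) * (x * (3 * (y / (1 - y)\<^sup>2) + 1 / (1 - y)))"
      using d by (simp add:  kern_def dkern_def Qd' flip: x_def) (simp add: algebra_simps)
    moreover have "?g (- int d) = real d ^ (k + 1) * ((- 1) ^ (k + 1) * x\<^sup>2 * (3 * (y / (1 - y)\<^sup>2) + 2 * (1 / (1 - y))))"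
    proof -
      have k: "kern (q ^ 3) (- int d) = 1 - 1 / (1 - y)"
        using d q Q1 by (subst kern_minus) (auto simp: kern_def Qd Qd')
      have dk: "dkern (q ^ 3) (- int d) = y / (1 - y)\<^sup>2"
        using d q Q1 by (subst dkern_minus) (auto simp: dkern_def Qd Qd')
      have "kern (q ^ 3) (- int d) + 3 * dkern (q ^ 3) (- int d) = y * (3 * (y / (1 - y)\<^sup>2) + 2 * (1 / (1 - y)))"
        unfolding k dk using y by (simp add: divide_simps) (simp add: power2_eq_square algebra_simps)
      then have "(kern (q ^ 3) (- int d) + 3 * dkern (q ^ 3) (- int d)) * q powi (- int d)
          = x\<^sup>2 * (3 * (y / (1 - y)\<^sup>2) + 2 * (1 / (1 - y)))"
        using x by (simp add: power_int_minus power2_eq_square power3_eq_cube field_simps y_def flip: x_def)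
      then have "of_int (- int d) ^ (k + 1) * ((kern (q ^ 3) (- int d) + 3 * dkern (q ^ 3) (- int d)) * q powi (- int d))
          = (- real d) ^ (k + 1) * (x\<^sup>2 * (3 * (y / (1 - y)\<^sup>2) + 2 * (1 / (1 - y))))"
        by simp
      also have "(- real d) ^ (k + 1) = real d ^ (k + 1) * (- 1) ^ (k + 1)"
        by (simp add: power_minus[of "real d"])
      also have "of_int (- int d) ^ (k + 1) * ((kern (q ^ 3) (- int d) + 3 * dkern (q ^ 3) (- int d)) * q powi (- int d))
          = ?g (- int d)" by (simp only: distrib_left distrib_right mult_ac)
      finally show ?thesis by (simp only: mult_ac)
    qed
    ultimately show "((\<lambda>m. real (d * m) * (real d ^ k * chi3 k m) * (q ^ d) ^ m) has_sum ?g (int d) + ?g (- int d)) {1..}"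
      by (simp add: x_def algebra_simps)
  qed
  moreover have "((\<lambda>d. ?g (int d) + ?g (- int d)) has_sum zeta3 (k + 1) q + 3 * xi3 (k + 1) q - ?g 0) {1..}"
    unfolding zeta3_def xi3_def
    by (rule has_sum_int_pair, intro has_sum_add has_sum_cmult_right has_sum_zeta has_sum_xi) (use annulus[OF q] in auto)
  ultimately have "zeta3 (k + 1) q + 3 * xi3 (k + 1) q - ?g 0 = eval_fps (fps_X * fps_deriv (zeta3_fps k)) q"
    using has_sum_unique by blast
  then show ?thesis by (simp add: kern_def)
qed

section \<open>Differential equations and product formulas\<close>

text \<open>
The generating function of the sum of divisors, that is, the Eisenstein series of weight 2 without
its constant term.
\<close>
definition sigma_fps :: "real fps" where
  "sigma_fps = lambert (\<lambda>d m. real d)"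

text \<open>
The logarithm of the infinite product of the \<open>1 - q^d\<close>, expanded by the logarithmic series.
\<close>
definition log_euler_fps :: "real fps" where
  "log_euler_fps = lambert (\<lambda>d m. - (1 / real m))"

lemma sigma_poly_bounded: "poly_bounded (\<lambda>d m. real d)"
proof (rule poly_boundedI[of _ 1 1])
  fix d m :: nat assume "d \<ge> 1" "m \<ge> 1"
  then have "d * 1 \<le> d * m" by (intro mult_le_mono2)
  then have "real d \<le> real (d * m)" by (metis mult.right_neutral of_nat_le_iff)
  then show "\<bar>real d\<bar> \<le> 1 * real (d * m) ^ 1" by simp
qed

lemma log_euler_poly_bounded: "poly_bounded (\<lambda>d m. - (1 / real m))"
  by (rule poly_boundedI[of _ 1 0]) (auto simp: field_simps)

lemma conv_radii:
  "fps_conv_radius (zeta3_fps k) \<ge> 1" "fps_conv_radius sigma_fps \<ge> 1" "fps_conv_radius log_euler_fps \<ge> 1"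
  unfolding zeta3_fps_def sigma_fps_def log_euler_fps_def
  by (intro lambert_conv_radius zeta3_poly_bounded sigma_poly_bounded log_euler_poly_bounded)+

lemma has_sum_log_euler:
  assumes q: "0 < q" "q < 1"
  shows "((\<lambda>d. ln (1 - q ^ d)) has_sum eval_fps log_euler_fps q) {1..}"
  unfolding log_euler_fps_def
proof (rule has_sum_lambert_inner[OF log_euler_poly_bounded q])
  fix d :: nat assume "d \<ge> 1"
  define x where "x = q ^ d"
  have x: "0 < x" "x < 1" using q \<open>d \<ge> 1\<close> by (auto simp: x_def power_less_one_iff)
  have "(\<lambda>n. - ((- (- x)) ^ n) / real n) sums ln (1 + - x)"
    by (rule ln_series') (use x in simp)
  then have s: "(\<lambda>m. - (1 / real m) * x ^ m) sums ln (1 - x)" by simp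
  have "summable (\<lambda>m. norm (- (1 / real m) * x ^ m))"
  proof (rule summable_comparison_test'[of "\<lambda>m. x ^ m"])
    show "norm (norm (- (1 / real m) * x ^ m)) \<le> x ^ m" if "m \<ge> 0" for m
      using x by (cases "m = 0") (auto simp: field_simps)
  qed (use x in \<open>simp add: summable_geometric\<close>)
  then have "((\<lambda>m. - (1 / real m) * x ^ m) has_sum ln (1 - x)) UNIV"
    using s by (rule norm_summable_imp_has_sum)
  then show "((\<lambda>m. - (1 / real m) * (q ^ d) ^ m) has_sum ln (1 - q ^ d)) {1..}"
    unfolding x_def[symmetric]
    by (rule has_sum_cong_neutral[THEN iffD1, rotated -1]) (auto simp: not_less_eq_eq)
qed

lemma euler_product:
  assumes q: "0 < q" "q < (1::real)"
  shows "(\<lambda>n. 1 - q ^ Suc n) has_prod exp (eval_fps log_euler_fps q)"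
proof -
  have "((\<lambda>n. ln (1 - q ^ Suc n)) has_sum eval_fps log_euler_fps q) UNIV"
    by (rule has_sum_reindex_bij_witness[of _ "\<lambda>d. d - 1" Suc, THEN iffD2, OF _ _ _ _ _ _ has_sum_log_euler[OF q]]) auto
  then have "(\<lambda>n. exp (ln (1 - q ^ Suc n))) has_prod exp (eval_fps log_euler_fps q)"
    unfolding has_prod_def by (intro disjI1 sums_imp_has_prod_exp has_sum_imp_sums)
  moreover have "exp (ln (1 - q ^ Suc n)) = 1 - q ^ Suc n" for n
  proof -
    have "q ^ Suc n < 1" using q by (subst power_less_one_iff) auto
    then show ?thesis by (intro exp_ln) linarith
  qed
  ultimately show ?thesis by simp
qed

text \<open>
The logarithmic derivative of the Dedekind eta function is an Eisenstein series of weight 2.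
\<close>
lemma X_deriv_log_euler: "fps_X * fps_deriv log_euler_fps = - sigma_fps"
  unfolding log_euler_fps_def X_deriv_lambert sigma_fps_def
proof (rule fps_ext)
  fix N
  show "fps_nth (lambert (\<lambda>d m. real (d * m) * - (1 / real m))) N = fps_nth (- lambert (\<lambda>d m. real d)) N"
  proof (cases "N = 0")
    case False
    then have "(\<Sum>d | d dvd N. real (d * (N div d)) * - (1 / real (N div d))) = (\<Sum>d | d dvd N. - real d)"
      by (intro sum.cong) (auto elim!: dvdE)
    then show ?thesis by (simp only: lambert_def fps_nth_Abs_fps fps_neg_nth sum_negf)
  qed (simp add: lambert_def)
qed

lemma sigma_zeta3:
  assumes q: "0 < q" "q < 1"
  shows "zeta3 1 q = eval_fps sigma_fps q - eval_fps sigma_fps (q ^ 3)"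
proof -
  have q3: "0 < q ^ 3" "q ^ 3 < 1" using q by (auto simp: power_less_one_iff)
  let ?A = "{1..} \<times> {1..} :: (nat \<times> nat) set"
  have 1: "((\<lambda>(d, m). real d * q ^ (d * m)) has_sum eval_fps sigma_fps q) ?A"
    unfolding sigma_fps_def by (rule has_sum_lambert[OF sigma_poly_bounded q])
  have "((\<lambda>(d, m). real d * (q ^ 3) ^ (d * m)) has_sum eval_fps sigma_fps (q ^ 3)) ?A"
    unfolding sigma_fps_def by (rule has_sum_lambert[OF sigma_poly_bounded q3])
  then have "((\<lambda>(d, m). real d * q ^ (d * m)) has_sum eval_fps sigma_fps (q ^ 3)) ({1..} \<times> {m. m \<ge> 1 \<and> 3 dvd m})"
    by (rule has_sum_reindex_bij_witness[of _ "\<lambda>(d, m). (d, m div 3)" "\<lambda>(d, m). (d, 3 * m)", THEN iffD1, rotated -1])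
      (auto simp: mult_ac simp flip: power_mult elim!: dvdE)
  then have 2: "((\<lambda>(d, m). if 3 dvd m then real d * q ^ (d * m) else 0) has_sum eval_fps sigma_fps (q ^ 3)) ?A"
    by (rule has_sum_cong_neutral[THEN iffD1, rotated -1]) (auto split: if_splits)
  have 3: "((\<lambda>(d, m). real d ^ 1 * chi3 1 m * q ^ (d * m)) has_sum eval_fps (zeta3_fps 1) q) ?A"
    unfolding zeta3_fps_def by (rule has_sum_lambert[OF zeta3_poly_bounded(1) q])
  have "real d ^ 1 * chi3 1 m * q ^ (d * m) = real d * q ^ (d * m) - (if 3 dvd m then real d * q ^ (d * m) else 0)" for d m
  proof -
    have "chi3 1 m = (if 3 dvd m then 0 else 1)"
      unfolding chi3_def by (auto simp: dvd_eq_mod_eq_0)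
    then show ?thesis by simp
  qed
  then have "((\<lambda>(d, m). real d ^ 1 * chi3 1 m * q ^ (d * m)) has_sum
      eval_fps sigma_fps q - eval_fps sigma_fps (q ^ 3)) ?A"
    using has_sum_diff_real[OF 1 2] by (simp add: case_prod_unfold)
  then have "eval_fps (zeta3_fps 1) q = eval_fps sigma_fps q - eval_fps sigma_fps (q ^ 3)"
    using has_sum_unique[OF 3] by blast
  then show ?thesis using zeta3_eq_eval_fps[OF q, of 1] by simp
qed

text \<open>
Expanding \<open>q^d / (1 - q^d)^2\<close> leads to the Lambert series with coefficient \<open>m\<close>, which differs from
\<open>sigma_fps\<close> only by exchanging complementary divisors.
\<close>
lemma infsum_dkern:
  assumes q: "0 < q" "q < 1"
  shows "infsum (dkern q) UNIV = 2 * eval_fps sigma_fps q"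
proof -
  have "sigma_fps = lambert (\<lambda>d m. real m)"
    unfolding sigma_fps_def
  proof (rule fps_ext)
    fix N
    have "(\<Sum>d | d dvd N. real d) = (\<Sum>d | d dvd N. real (N div d))" if "N > 0"
      by (rule sum.reindex_bij_witness[of _ "\<lambda>d. N div d" "\<lambda>d. N div d"])
        (use that in \<open>auto simp: div_div_eq_right\<close>)
    then show "fps_nth (lambert (\<lambda>d m. real d)) N = fps_nth (lambert (\<lambda>d m. real m)) N"
      by (cases "N = 0") (auto simp: lambert_def)
  qed
  moreover have "poly_bounded (\<lambda>d m. real m)"
  proof (rule poly_boundedI[of _ 1 1])
    fix d m :: nat assume "d \<ge> 1" "m \<ge> 1"
    then have "1 * m \<le> d * m" by (intro mult_le_mono1)
    then have "real m \<le> real (d * m)" by (metis mult_1 of_nat_le_iff)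
    then show "\<bar>real m\<bar> \<le> 1 * real (d * m) ^ 1" by simp
  qed
  moreover have "((\<lambda>m. real m * (q ^ d) ^ m) has_sum dkern q (int d)) {1..}" if d: "d \<ge> 1" for d
  proof -
    have "0 < q ^ d" "q ^ d < 1" using q d by (auto simp: power_less_one_iff)
    then have "((\<lambda>m. real m * (q ^ d) ^ m) has_sum dkern q (int d)) UNIV"
      using has_sum_geometric_real(2)[of "q ^ d"] d by (simp add: dkern_def)
    then show ?thesis
      by (rule has_sum_cong_neutral[THEN iffD1, rotated -1]) (auto simp: not_less_eq_eq)
  qed
  ultimately have "((\<lambda>d. dkern q (int d)) has_sum eval_fps sigma_fps q) {1..}"
    using has_sum_lambert_inner[OF _ q, of "\<lambda>d m. real m" "\<lambda>d. dkern q (int d)"] by simp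
  then have "((\<lambda>d. dkern q (int d) + dkern q (- int d)) has_sum eval_fps sigma_fps q + eval_fps sigma_fps q) {1..}"
    unfolding dkern_minus[OF q] by (intro has_sum_add)
  moreover have "((\<lambda>d. dkern q (int d) + dkern q (- int d)) has_sum infsum (dkern q) UNIV - dkern q 0) {1..}"
    by (rule has_sum_int_pair[OF has_sum_dkern[OF q]])
  ultimately show ?thesis using has_sum_unique by (fastforce simp: dkern_def)
qed

abbreviation eval_log :: "real \<Rightarrow> real" where
  "eval_log \<equiv> eval_fps log_euler_fps"

lemma eval_X_deriv:
  assumes "fps_conv_radius f \<ge> 1" "\<bar>q\<bar> < (1::real)"
  shows "eval_fps (fps_X * fps_deriv f) q = q * eval_fps (fps_deriv f) q"
proof -
  have "ereal \<bar>q\<bar> < fps_conv_radius (fps_deriv f)"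
    using assms order_trans[OF assms(1) fps_conv_radius_deriv] less_le_trans[of "ereal \<bar>q\<bar>" 1] by simp
  then show ?thesis by (subst eval_fps_mult) auto
qed

lemma DERIV_eval_fps:
  assumes "fps_conv_radius f \<ge> 1" "0 < q" "q < (1::real)"
  shows "(eval_fps f has_real_derivative eval_fps (fps_X * fps_deriv f) q / q) (at q)"
proof -
  have "ereal (norm q) < fps_conv_radius f"
    using assms less_le_trans[of "ereal q" 1] by simp
  from has_field_derivative_eval_fps[OF this] show ?thesis
    using assms by (subst eval_X_deriv) auto
qed

lemma DERIV_eval_log:
  assumes "0 < q" "q < (1::real)"
  shows "(eval_log has_real_derivative - eval_fps sigma_fps q / q) (at q)"
proof -
  have "ereal (norm q) < fps_conv_radius sigma_fps"
    using conv_radii(2) assms less_le_trans[of "ereal q" 1] by simp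
  then show ?thesis
    using DERIV_eval_fps[OF conv_radii(3) assms] by (simp add: X_deriv_log_euler eval_fps_minus)
qed

lemma DERIV_eval_log_cube:
  assumes q: "0 < q" "q < (1::real)"
  shows "((\<lambda>q. eval_log (q ^ 3)) has_real_derivative - 3 * eval_fps sigma_fps (q ^ 3) / q) (at q)"
proof -
  have q3: "0 < q ^ 3" "q ^ 3 < 1" using q by (auto simp: power_less_one_iff)
  have "((\<lambda>q. eval_log (q ^ 3)) has_real_derivative - eval_fps sigma_fps (q ^ 3) / q ^ 3 * (3 * q\<^sup>2)) (at q)"
    using DERIV_chain2[where f = eval_log and g = "\<lambda>q. q ^ 3" and x = q, OF DERIV_eval_log[OF q3] DERIV_pow]
    by simp
  moreover have "- eval_fps sigma_fps (q ^ 3) / q ^ 3 * (3 * q\<^sup>2) = - 3 * eval_fps sigma_fps (q ^ 3) / q"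
    using q by (simp add: field_simps power2_eq_square power3_eq_cube)
  ultimately show ?thesis by simp
qed

text \<open>
These two equations are \<open>torsion_relations\<close> and \<open>xi3_values\<close> inserted into \<open>X_deriv_zeta3\<close>. On the right-hand side \<open>P\<close>
and \<open>R\<close> are multiples of logarithmic derivatives of infinite products, so the first equation can be integrated at once.
\<close>
lemma cubic_ode:
  assumes q: "0 < q" "q < (1::real)"
  defines "P \<equiv> eval_fps sigma_fps q" and "R \<equiv> eval_fps sigma_fps (q ^ 3)"
  shows "eval_fps (fps_X * fps_deriv (zeta3_fps 2)) q = zeta3 2 q * (1 + 3 * P - 27 * R)"
    and "eval_fps (fps_X * fps_deriv (zeta3_fps 0)) q = 3 / 2 * zeta3 2 q - (3 * zeta3 0 q - 1) * (P - R)"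
proof -
  have q3: "0 < q ^ 3" "q ^ 3 < 1" using q by (auto simp: power_less_one_iff)
  note rel = torsion_relations[OF q]
  note xi = xi3_values[OF q]
  have p: "zeta3 1 q = P - R" using sigma_zeta3[OF q] by (simp add: P_def R_def)
  have a2: "(6 * zeta3 0 q - 2)\<^sup>2 = 12 * (P - R) + 1 - 24 * R"
    using rel(4) infsum_dkern[OF q3] p by (simp add: R_def)
  have "eval_fps (fps_X * fps_deriv (zeta3_fps 2)) q = zeta3 3 q + 3 * xi3 3 q"
    using X_deriv_zeta3[OF q, of 2] by simp
  also have "\<dots> = zeta3 2 q * ((6 * zeta3 0 q - 2)\<^sup>2 - 9 * (P - R))"
    unfolding xi rel(1) p by (simp add: power2_eq_square algebra_simps)
  also have "\<dots> = zeta3 2 q * (1 + 3 * P - 27 * R)"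
    unfolding a2 by (simp add: algebra_simps)
  finally show "eval_fps (fps_X * fps_deriv (zeta3_fps 2)) q = zeta3 2 q * (1 + 3 * P - 27 * R)" .
  have "eval_fps (fps_X * fps_deriv (zeta3_fps 0)) q = zeta3 1 q + 3 * xi3 1 q"
    using X_deriv_zeta3[OF q, of 0] by simp
  also have "\<dots> = 3 / 2 * zeta3 2 q - (3 * zeta3 0 q - 1) * (P - R)"
    unfolding rel(5) p by (simp add: algebra_simps)
  finally show "eval_fps (fps_X * fps_deriv (zeta3_fps 0)) q = 3 / 2 * zeta3 2 q - (3 * zeta3 0 q - 1) * (P - R)" .
qed

lemma eval_conv: "fps_conv_radius f \<ge> 1 \<Longrightarrow> 0 \<le> q \<Longrightarrow> q < (1::real) \<Longrightarrow> ereal \<bar>q\<bar> < fps_conv_radius f"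
  using less_le_trans[of "ereal q" 1 "fps_conv_radius f"] by simp

lemma continuous_eval_pow:
  assumes "fps_conv_radius f \<ge> 1" "r < 1" "k > 0"
  shows "continuous_on {0..r::real} (\<lambda>q. eval_fps f (q ^ k))"
proof (intro continuous_on_eval_fps' continuous_intros)
  show "(\<lambda>q. q ^ k) ` {0..r} \<subseteq> eball 0 (fps_conv_radius f)"
  proof safe
    fix q assume "q \<in> {0..r}"
    then have "0 \<le> q" "q < 1" using assms by auto
    then have "0 \<le> q ^ k" "q ^ k < 1" using assms by (auto simp: power_less_one_iff)
    then show "q ^ k \<in> eball 0 (fps_conv_radius f)"
      using eval_conv[OF assms(1), of "q ^ k"] by (simp add: in_eball_iff)
  qed
qed

text \<open>
The quotient of both sides has derivative 0 by \<open>cubic_ode\<close>. To start at \<open>q = 0\<close>, where the quotient is 1,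
the factor \<open>q\<close> is first removed from the power series.
\<close>
lemma zeta3_2_product:
  assumes r: "0 < r" "r < 1"
  shows "zeta3 2 r = r * exp (9 * eval_log (r ^ 3) - 3 * eval_log r)"
proof -
  define s where "s = fps_shift 1 (zeta3_fps 2)"
  have z0: "fps_nth (zeta3_fps 2) 0 = 0" by (simp add: zeta3_fps_def lambert_def)
  have zs: "zeta3_fps 2 = fps_X * s"
    using z0 by (intro fps_ext) (auto simp: s_def)
  have srad: "fps_conv_radius s \<ge> 1" using conv_radii(1)[of 2] by (simp add: s_def)
  have ev: "zeta3 2 q = q * eval_fps s q" if "0 < q" "q < 1" for q
    using that eval_conv[OF srad, of q]
    by (simp add: zeta3_eq_eval_fps[OF that] zs eval_fps_mult)
  \<comment> \<open>The quotient of the two sides of the claim.\<close>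
  define h where "h q = eval_fps s q * exp (3 * eval_log q - 9 * eval_log (q ^ 3))" for q
  have "h r = h 0"
  proof (rule DERIV_isconst_end[OF r(1)])
    have c1: "continuous_on {0..r} (eval_fps s)" "continuous_on {0..r} eval_log"
      "continuous_on {0..r} (\<lambda>q. eval_log (q ^ 3))"
      using continuous_eval_pow[OF srad r(2), of 1] continuous_eval_pow[OF conv_radii(3) r(2), of 1]
        continuous_eval_pow[OF conv_radii(3) r(2), of 3] by simp_all
    show "continuous_on {0..r} h" unfolding h_def by (intro continuous_intros c1)
    fix q assume "0 < q" "q < r"
    with r have q: "0 < q" "q < 1" by auto
    have "fps_X * fps_deriv (zeta3_fps 2) = fps_X * s + fps_X * (fps_X * fps_deriv s)"
      unfolding zs by (simp add: algebra_simps)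
    moreover have rad: "fps_conv_radius (fps_X * fps_deriv s) \<ge> 1"
      using order_trans[OF srad fps_conv_radius_deriv] order_trans[OF _ fps_conv_radius_mult, of 1 fps_X "fps_deriv s"]
      by simp
    moreover have rads: "fps_conv_radius (fps_X * s) \<ge> 1" "fps_conv_radius (fps_X * (fps_X * fps_deriv s)) \<ge> 1"
      using srad rad order_trans[OF _ fps_conv_radius_mult, of 1 fps_X s]
        order_trans[OF _ fps_conv_radius_mult, of 1 fps_X "fps_X * fps_deriv s"] by simp_all
    ultimately have e: "eval_fps (fps_X * fps_deriv (zeta3_fps 2)) q
        = q * eval_fps s q + q * eval_fps (fps_X * fps_deriv s) q"
      using q eval_conv[OF srad, of q] eval_conv[OF rad, of q] eval_conv[OF rads(1), of q] eval_conv[OF rads(2), of q]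
      by (simp add: eval_fps_add eval_fps_mult)
    have "q * eval_fps (fps_X * fps_deriv s) q
        = q * (eval_fps s q * (3 * eval_fps sigma_fps q - 27 * eval_fps sigma_fps (q ^ 3)))"
      using e unfolding cubic_ode(1)[OF q] ev[OF q] by (simp add: algebra_simps)
    then have sd: "eval_fps (fps_X * fps_deriv s) q
        = eval_fps s q * (3 * eval_fps sigma_fps q - 27 * eval_fps sigma_fps (q ^ 3))"
      using q by simp
    have "(h has_real_derivative
        eval_fps (fps_X * fps_deriv s) q / q * exp (3 * eval_log q - 9 * eval_log (q ^ 3))
        + exp (3 * eval_log q - 9 * eval_log (q ^ 3)) * (3 * (- eval_fps sigma_fps q / q)
          - 9 * (- 3 * eval_fps sigma_fps (q ^ 3) / q)) * eval_fps s q) (at q)"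
      unfolding h_def
      by (intro DERIV_mult DERIV_eval_fps[OF srad q] DERIV_chain2[OF DERIV_exp] DERIV_diff DERIV_cmult
          DERIV_eval_log[OF q] DERIV_eval_log_cube[OF q])
    moreover have "eval_fps (fps_X * fps_deriv s) q / q * exp (3 * eval_log q - 9 * eval_log (q ^ 3))
        + exp (3 * eval_log q - 9 * eval_log (q ^ 3)) * (3 * (- eval_fps sigma_fps q / q)
          - 9 * (- 3 * eval_fps sigma_fps (q ^ 3) / q)) * eval_fps s q = 0"
      unfolding sd using q by (simp add: field_simps)
    ultimately show "(h has_real_derivative 0) (at q)" by simp
  qed
  also have "h 0 = 1"
    by (simp add: h_def eval_fps_at_0 s_def zeta3_fps_def lambert_def log_euler_fps_def chi3_def)
  finally have "eval_fps s r * exp (3 * eval_log r - 9 * eval_log (r ^ 3)) = 1" by (simp add: h_def)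
  then have "eval_fps s r = exp (9 * eval_log (r ^ 3) - 3 * eval_log r)"
    by (simp add: exp_diff field_simps)
  then show ?thesis using ev[OF r] by simp
qed

text \<open>
The cubic identity \<open>a^3 = b^3 + c^3\<close> of the Borweins with \<open>b^3\<close> in product form. Since \<open>cubic_ode\<close>
gives the derivatives of both \<open>a\<close> and \<open>zeta3 2\<close>, the function \<open>f = a^3 - 27 zeta3 2\<close> satisfies the linear equation
\<open>q f' = - 9 (P - R) f\<close>, and so does the product.
\<close>
lemma cubic_product:
  assumes r: "0 < r" "r < 1"
  shows "(6 * zeta3 0 r - 2) ^ 3 = 27 * zeta3 2 r + exp (9 * eval_log r - 3 * eval_log (r ^ 3))"
proof -
  define a c where "a q = 1 + 6 * eval_fps (zeta3_fps 0) q" and "c = eval_fps (zeta3_fps 2)" for q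
  have ac: "6 * zeta3 0 q - 2 = a q" "zeta3 2 q = c q" if "0 < q" "q < 1" for q
    using zeta3_eq_eval_fps[OF that] by (auto simp: a_def c_def)
  \<comment> \<open>The quotient of \<open>a^3 - 27 c\<close> by the product.\<close>
  define h where "h q = (a q ^ 3 - 27 * c q) * exp (3 * eval_log (q ^ 3) - 9 * eval_log q)" for q
  have "h r = h 0"
  proof (rule DERIV_isconst_end[OF r(1)])
    have c1: "continuous_on {0..r} (eval_fps (zeta3_fps 0))" "continuous_on {0..r} c" "continuous_on {0..r} eval_log"
      "continuous_on {0..r} (\<lambda>q. eval_log (q ^ 3))"
      using continuous_eval_pow[OF conv_radii(1) r(2), of 1] continuous_eval_pow[OF conv_radii(3) r(2), of 1]
        continuous_eval_pow[OF conv_radii(3) r(2), of 3] by (simp_all add: c_def)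
    show "continuous_on {0..r} h" unfolding h_def a_def by (intro continuous_intros c1)
    fix q assume "0 < q" "q < r"
    with r have q: "0 < q" "q < 1" by auto
    define P R where "P = eval_fps sigma_fps q" and "R = eval_fps sigma_fps (q ^ 3)"
    have a': "(a has_real_derivative (9 * c q - 3 * a q * (P - R)) / q) (at q)"
    proof -
      have "(a has_real_derivative 6 * (eval_fps (fps_X * fps_deriv (zeta3_fps 0)) q / q)) (at q)"
        unfolding a_def using DERIV_add[OF DERIV_const DERIV_cmult[OF DERIV_eval_fps[OF conv_radii(1) q]]] by simp
      moreover have "6 * eval_fps (fps_X * fps_deriv (zeta3_fps 0)) q = 9 * c q - 3 * a q * (P - R)"
        unfolding cubic_ode(2)[OF q] by (simp add: P_def R_def algebra_simps flip: ac[OF q])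
      ultimately show ?thesis by simp
    qed
    have c': "(c has_real_derivative c q * (1 + 3 * P - 27 * R) / q) (at q)"
      using DERIV_eval_fps[OF conv_radii(1)[of 2] q] unfolding cubic_ode(1)[OF q] 
      by (simp add: c_def[symmetric] P_def R_def ac[OF q])
    have a2: "a q ^ 2 = 1 + 12 * P - 36 * R"
    proof -
      have q3: "0 < q ^ 3" "q ^ 3 < 1" using q by (auto simp: power_less_one_iff)
      show ?thesis using torsion_relations(4)[OF q] infsum_dkern[OF q3] sigma_zeta3[OF q]
        by (simp add: P_def R_def ac[OF q])
    qed
    have "(h has_real_derivative
        ((real 3 * ((9 * c q - 3 * a q * (P - R)) / q * a q ^ (3 - Suc 0)) - 27 * (c q * (1 + 3 * P - 27 * R) / q))
          * exp (3 * eval_log (q ^ 3) - 9 * eval_log q)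
        + exp (3 * eval_log (q ^ 3) - 9 * eval_log q) * (3 * (- 3 * R / q) - 9 * (- P / q)) * (a q ^ 3 - 27 * c q))) (at q)"
      unfolding h_def P_def R_def
      by (intro DERIV_mult DERIV_chain2[OF DERIV_exp] DERIV_diff DERIV_cmult DERIV_power a'[unfolded P_def R_def]
          c'[unfolded P_def R_def] DERIV_eval_log[OF q] DERIV_eval_log_cube[OF q])
    moreover have "(real 3 * ((9 * c q - 3 * a q * (P - R)) / q * a q ^ (3 - Suc 0)) - 27 * (c q * (1 + 3 * P - 27 * R) / q))
          * E + E * (3 * (- 3 * R / q) - 9 * (- P / q)) * (a q ^ 3 - 27 * c q) = 0" for E
    proof -
      have "(real 3 * ((9 * c q - 3 * a q * (P - R)) * a q ^ 2) - 27 * (c q * (1 + 3 * P - 27 * R)))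
          + (9 * P - 9 * R) * (a q ^ 3 - 27 * c q) = 27 * c q * (a q ^ 2 - (1 + 12 * P - 36 * R))"
        by (simp add: power2_eq_square power3_eq_cube algebra_simps)
      also have "\<dots> = 0" using a2 by simp
      finally have "E / q * ((real 3 * ((9 * c q - 3 * a q * (P - R)) * a q ^ 2) - 27 * (c q * (1 + 3 * P - 27 * R)))
          + (9 * P - 9 * R) * (a q ^ 3 - 27 * c q)) = 0" by simp
      then show ?thesis by (simp add: divide_inverse power2_eq_square power3_eq_cube algebra_simps)
    qed
    ultimately show "(h has_real_derivative 0) (at q)" by simp
  qed
  also have "h 0 = 1"
    by (simp add: h_def a_def c_def eval_fps_at_0 zeta3_fps_def lambert_def log_euler_fps_def)
  finally have "(a r ^ 3 - 27 * c r) * exp (3 * eval_log (r ^ 3) - 9 * eval_log r) = 1" by (simp add: h_def)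
  then have "a r ^ 3 - 27 * c r = exp (9 * eval_log r - 3 * eval_log (r ^ 3))"
    by (simp add: exp_diff field_simps)
  then show ?thesis using ac[OF r] by simp
qed

text \<open>
The identity of weight 6 for real \<open>q\<close>: with \<open>a = 6 \<zeta>\<^sub>0 - 2\<close> and \<open>c = \<zeta>\<^sub>2\<close>, \<open>\<zeta>\<^sub>5 = a^3 c + 12 c^2 = 39 c^2 + (a^3 - 27 c) c\<close>,
and both \<open>c\<close> and \<open>a^3 - 27 c\<close> are products.
\<close>
lemma zeta3_5_eq:
  assumes q: "0 < q" "q < 1"
  shows "eval_fps (zeta3_fps 5) q = 39 * q\<^sup>2 * (exp (eval_log (q ^ 3)) ^ 3 / exp (eval_log q)) ^ 6
    + q * exp (eval_log q) ^ 6 * exp (eval_log (q ^ 3)) ^ 6"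
proof -
  define E1 E3 where "E1 = exp (eval_log q)" and "E3 = exp (eval_log (q ^ 3))"
  have E: "E1 \<noteq> 0" "E3 \<noteq> 0" by (auto simp: E1_def E3_def)
  have e: "exp (9 * eval_log (q ^ 3) - 3 * eval_log q) = E3 ^ 9 / E1 ^ 3"
    "exp (9 * eval_log q - 3 * eval_log (q ^ 3)) = E1 ^ 9 / E3 ^ 3"
    by (simp_all add: E1_def E3_def exp_diff flip: exp_of_nat_mult)
  define a c where "a = 6 * zeta3 0 q - 2" and "c = zeta3 2 q"
  have c: "c = q * (E3 ^ 9 / E1 ^ 3)" unfolding c_def zeta3_2_product[OF q] e ..
  have a3: "a ^ 3 = 27 * c + E1 ^ 9 / E3 ^ 3" using cubic_product[OF q] unfolding a_def c_def e .
  note rel = torsion_relations[OF q, folded a_def c_def]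
  have "eval_fps (zeta3_fps 5) q = zeta3 5 q" by (simp add: zeta3_eq_eval_fps[OF q])
  also have "\<dots> = a ^ 3 * c + 12 * c\<^sup>2" unfolding rel by (simp add: power3_eq_cube algebra_simps)
  also have "\<dots> = 39 * c\<^sup>2 + E1 ^ 9 / E3 ^ 3 * c" unfolding a3 by (simp add: power2_eq_square algebra_simps)
  also have "c\<^sup>2 = q\<^sup>2 * (E3 ^ 3 / E1) ^ 6"
    unfolding c by (simp add: power_mult_distrib power_divide flip: power_mult)
  also have "E1 ^ 9 / E3 ^ 3 * c = q * E1 ^ 6 * E3 ^ 6"
    unfolding c using E by (simp add: field_simps flip: power_add)
  finally show ?thesis by (simp add: E1_def E3_def)
qed

section \<open>Euler's expansion, split modulo three\<close>

definition qpoch :: "real \<Rightarrow> nat \<Rightarrow> real" where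
  "qpoch y N = (\<Prod>i<N. 1 - y ^ Suc i)"

text \<open>
Euler's expansion in powers of \<open>z\<close> of the product \<open>E(z)\<close> of the \<open>1 + z q^i\<close> over \<open>i \<ge> 0\<close>. It is characterized
by \<open>E(0) = 1\<close> and the functional equation \<open>E(z) = (1 + z) E(q z)\<close>.
\<close>
definition euler_fps :: "real \<Rightarrow> real fps" where
  "euler_fps q = Abs_fps (\<lambda>N. q ^ (N choose 2) / qpoch q N)"

lemma qpoch_pos: "0 < y \<Longrightarrow> y < 1 \<Longrightarrow> 0 < qpoch y N"
  unfolding qpoch_def by (intro prod_pos) (auto simp: power_less_one_iff simp del: power_Suc)

lemma euler_fps_functional:
  assumes q: "0 < q" "q < 1"
  shows "euler_fps q = (1 + fps_X) * (euler_fps q oo (fps_const q * fps_X))"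
proof (rule fps_ext)
  fix N
  show "fps_nth (euler_fps q) N = fps_nth ((1 + fps_X) * (euler_fps q oo (fps_const q * fps_X))) N"
  proof (cases N)
    case (Suc M)
    have c: "Suc M choose 2 = (M choose 2) + M" by (simp add: numeral_2_eq_2)
    have p: "qpoch q (Suc M) = qpoch q M * (1 - q ^ Suc M)" by (simp add: qpoch_def)
    have nz: "qpoch q M \<noteq> 0" "1 - q ^ Suc M \<noteq> 0"
      using qpoch_pos[OF q, of M] qpoch_pos[OF q, of "Suc M"] unfolding p by auto
    have "q ^ (M choose 2) * q ^ M / (qpoch q M * (1 - q ^ Suc M))
      = q ^ Suc M * (q ^ (M choose 2) * q ^ M / (qpoch q M * (1 - q ^ Suc M))) + q ^ M * (q ^ (M choose 2) / qpoch q M)"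
      using nz by (simp add: divide_simps del: power_Suc) (simp add: algebra_simps)
    moreover have "fps_nth ((1 + fps_X) * (euler_fps q oo (fps_const q * fps_X))) (Suc M)
      = q ^ Suc M * fps_nth (euler_fps q) (Suc M) + q ^ M * fps_nth (euler_fps q) M"
      by (simp add: distrib_right del: power_Suc)
    ultimately show ?thesis unfolding Suc
      by (simp only: euler_fps_def fps_nth_Abs_fps c p power_add)
  qed (simp add: euler_fps_def qpoch_def)
qed

lemma euler_fps_unique:
  assumes q: "0 < q" "q < (1::real)" and F0: "fps_nth F 0 = 1"
    and F: "F = (1 + fps_X) * (F oo (fps_const q * fps_X))"
  shows "F = euler_fps q"
proof (rule fps_ext)
  have rec: "fps_nth G (Suc N) * (1 - q ^ Suc N) = q ^ N * fps_nth G N"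
    if "G = (1 + fps_X) * (G oo (fps_const q * fps_X))" for G :: "real fps" and N
  proof -
    have "fps_nth G (Suc N) = q ^ Suc N * fps_nth G (Suc N) + q ^ N * fps_nth G N"
      using arg_cong[OF that, of "\<lambda>F. fps_nth F (Suc N)"] by (simp add: distrib_right del: power_Suc)
    then show ?thesis by (simp add: right_diff_distrib mult.commute del: power_Suc)
  qed
  fix N
  show "fps_nth F N = fps_nth (euler_fps q) N"
  proof (induction N)
    case 0
    then show ?case by (simp add: F0 euler_fps_def qpoch_def binomial_eq_0)
  next
    case (Suc N)
    have "q ^ Suc N < 1" using q by (subst power_less_one_iff) auto
    then have "1 - q ^ Suc N \<noteq> 0" by linarith
    then show ?case
      using rec[OF F, of N] rec[OF euler_fps_functional[OF q], of N] Suc.IH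
      by (metis mult_cancel_right)
  qed
qed

lemma compose_linear_twice:
  fixes f :: "real fps"
  shows "f oo (fps_const c * fps_X) oo (fps_const d * fps_X) = f oo (fps_const (c * d) * fps_X)"
  by (rule fps_ext) (simp add: power_mult_distrib)

text \<open>
The factors \<open>1 + z q^i\<close> are sorted by \<open>i\<close> modulo 3; each class forms a product of the same kind with
\<open>q^3\<close> in place of \<open>q\<close>. The proof verifies the functional equation for the right-hand side.
\<close>
lemma euler_fps_trisection:
  assumes q: "0 < q" "q < 1"
  shows "euler_fps q = euler_fps (q ^ 3) * (euler_fps (q ^ 3) oo (fps_const q * fps_X))
    * (euler_fps (q ^ 3) oo (fps_const (q\<^sup>2) * fps_X))"
proof (rule euler_fps_unique[OF q, symmetric])
  let ?E = "euler_fps (q ^ 3)" and ?L = "\<lambda>c. fps_const c * fps_X"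
  have q3: "0 < q ^ 3" "q ^ 3 < 1" using q by (auto simp: power_less_one_iff)
  show "fps_nth (?E * (?E oo ?L q) * (?E oo ?L (q\<^sup>2))) 0 = 1"
    by (simp add: euler_fps_def qpoch_def binomial_eq_0)
  have "(?E * (?E oo ?L q) * (?E oo ?L (q\<^sup>2))) oo ?L q
      = (?E oo ?L q) * (?E oo ?L (q\<^sup>2)) * (?E oo ?L (q ^ 3))"
  proof -
    have "?E oo ?L q oo ?L q = ?E oo ?L (q\<^sup>2)" "?E oo ?L (q\<^sup>2) oo ?L q = ?E oo ?L (q ^ 3)"
      unfolding compose_linear_twice by (simp_all add: power2_eq_square power3_eq_cube mult.assoc)
    then show ?thesis by (simp add: fps_compose_mult_distrib)
  qed
  then have "(1 + fps_X) * ((?E * (?E oo ?L q) * (?E oo ?L (q\<^sup>2))) oo ?L q)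
      = ((1 + fps_X) * (?E oo ?L (q ^ 3))) * (?E oo ?L q) * (?E oo ?L (q\<^sup>2))"
    by (simp add: mult_ac)
  then show "?E * (?E oo ?L q) * (?E oo ?L (q\<^sup>2))
      = (1 + fps_X) * ((?E * (?E oo ?L q) * (?E oo ?L (q\<^sup>2))) oo ?L q)"
    by (simp flip: euler_fps_functional[OF q3])
qed

definition triples :: "nat \<Rightarrow> (nat \<times> nat \<times> nat) set" where
  "triples N = {(a, b, c). a + b + c = N}"

lemma triple_product_nth:
  fixes f g h :: "real fps"
  shows "fps_nth (f * g * h) N = (\<Sum>(a, b, c)\<in>triples N. fps_nth f a * fps_nth g b * fps_nth h c)"
proof -
  have "fps_nth (f * g * h) N = (\<Sum>i=0..N. \<Sum>j=0..i. fps_nth f j * fps_nth g (i - j) * fps_nth h (N - i))"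
    by (simp add: fps_mult_nth sum_distrib_right)
  also have "\<dots> = (\<Sum>(i, j)\<in>Sigma {0..N} (\<lambda>i. {0..i}). fps_nth f j * fps_nth g (i - j) * fps_nth h (N - i))"
    by (rule sum.Sigma) auto
  also have "\<dots> = (\<Sum>(a, b, c)\<in>triples N. fps_nth f a * fps_nth g b * fps_nth h c)"
    by (rule sum.reindex_bij_witness[of _ "\<lambda>(a, b, c). (a + b, a)" "\<lambda>(i, j). (j, i - j, N - i)"])
      (auto simp: triples_def)
  finally show ?thesis .
qed

lemma finite_trisection:
  assumes q: "0 < q" "q < 1"
  shows "q ^ (N choose 2) / qpoch q N = (\<Sum>(a, b, c)\<in>triples N.
    q ^ (b + 2 * c + 3 * ((a choose 2) + (b choose 2) + (c choose 2))) / (qpoch (q ^ 3) a * qpoch (q ^ 3) b * qpoch (q ^ 3) c))"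
proof -
  have "q ^ (N choose 2) / qpoch q N = fps_nth (euler_fps q) N" by (simp add: euler_fps_def)
  also have "\<dots> = (\<Sum>(a, b, c)\<in>triples N. fps_nth (euler_fps (q ^ 3)) a * fps_nth (euler_fps (q ^ 3) oo (fps_const q * fps_X)) b
      * fps_nth (euler_fps (q ^ 3) oo (fps_const (q\<^sup>2) * fps_X)) c)"
    by (subst euler_fps_trisection[OF q]) (rule triple_product_nth)
  also have "\<dots> = (\<Sum>(a, b, c)\<in>triples N.
    q ^ (b + 2 * c + 3 * ((a choose 2) + (b choose 2) + (c choose 2))) / (qpoch (q ^ 3) a * qpoch (q ^ 3) b * qpoch (q ^ 3) c))"
    by (intro sum.cong) (auto simp: euler_fps_def power_add power_mult distrib_left)
  finally show ?thesis .
qed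

section \<open>Beta-sets of 3-cores\<close>

definition part_at :: "nat list \<Rightarrow> nat \<Rightarrow> nat" where
  "part_at xs i = (if i < length xs then xs ! i else 0)"

text \<open>
For \<open>N = length xs\<close> these are the hook lengths of the first column. For larger \<open>N\<close> the partition is padded with
zeros, so that partitions of different lengths have beta-sets of the same size.
\<close>
definition beta_set :: "nat \<Rightarrow> nat list \<Rightarrow> nat set" where
  "beta_set N xs = (\<lambda>i. part_at xs i + (N - 1 - i)) ` {..<N}"

definition t_closed :: "nat \<Rightarrow> nat set \<Rightarrow> bool" where
  "t_closed t X \<longleftrightarrow> (\<forall>x\<in>X. t \<le> x \<longrightarrow> x - t \<in> X)"

lemma part_antimono:
  assumes "is_partition xs" "i \<le> j"
  shows "part_at xs j \<le> part_at xs i"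
proof (cases "i < j \<and> j < length xs")
  case True
  then have "xs ! j \<le> xs ! i"
    using assms(1) sorted_wrt_nth_less[of "(\<ge>)" xs i j] unfolding is_partition_def by blast
  then show ?thesis using True by (simp add: part_at_def)
next
  case False
  then have "i = j \<or> part_at xs j = 0" using assms(2) by (auto simp: part_at_def)
  then show ?thesis by auto
qed

lemma beta_strict:
  assumes "is_partition xs" "i < j" "j < N"
  shows "part_at xs j + (N - 1 - j) < part_at xs i + (N - 1 - i)"
  using part_antimono[OF assms(1) less_imp_le[OF assms(2)]] assms(2,3) by linarith

lemma hook_length_eq:
  assumes xs: "is_partition xs" and ij: "i < length xs" "j < xs ! i"
    and c: "{k. k < length xs \<and> j < xs ! k} = {..<c}"
  shows "hook_length xs i j = (xs ! i - j) + (c - i) - 1" "i < c"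
proof -
  have c': "k < length xs \<and> j < xs ! k \<longleftrightarrow> k < c" for k using c by blast
  show ic: "i < c" using ij c' by blast
  have arm: "{j'. j < j' \<and> (i, j') \<in> young_diagram xs} = {Suc j..<xs ! i}"
    using ij by (auto simp: young_diagram_def)
  have leg: "{i'. i < i' \<and> (i', j) \<in> young_diagram xs} = {Suc i..<c}"
    unfolding young_diagram_def using c' by (intro set_eqI) (simp add: Suc_le_eq)
  show "hook_length xs i j = (xs ! i - j) + (c - i) - 1"
    unfolding hook_length_def arm leg using ij ic by simp
qed

lemma initial_segment:
  fixes A :: "nat set"
  assumes "finite A" "\<And>i j. j \<in> A \<Longrightarrow> i \<le> j \<Longrightarrow> i \<in> A"
  shows "A = {..<card A}"
proof -
  have "\<exists>m. A = {..<m}"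
  proof (cases "A = {}")
    case True
    then show ?thesis by (intro exI[of _ 0]) simp
  next
    case False
    have "x \<in> A \<longleftrightarrow> x < Suc (Max A)" for x
      using assms(2)[OF Max_in[OF assms(1) False], of x] Max_ge[OF assms(1), of x]
      unfolding less_Suc_eq_le by blast
    then show ?thesis by (intro exI[of _ "Suc (Max A)"] set_eqI) simp
  qed
  then show ?thesis by auto
qed

text \<open>
The cells of row \<open>i\<close> correspond to the numbers below the \<open>i\<close>-th element \<open>b\<close> of the beta-set that do not belong
to it. The cell in column \<open>j\<close> corresponds to \<open>N + j - c\<close>, where \<open>c\<close> is the length of that
column, and its hook length is the distance to \<open>b\<close>.
\<close>
lemma hook_iff_gap:
  assumes xs: "is_partition xs" and N: "length xs \<le> N" and i: "i < length xs" and h: "h > 0"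
  defines "b \<equiv> xs ! i + (N - 1 - i)"
  shows "(\<exists>j<xs ! i. hook_length xs i j = h) \<longleftrightarrow> h \<le> b \<and> b - h \<notin> beta_set N xs"
proof
  assume "\<exists>j<xs ! i. hook_length xs i j = h"
  then obtain j where j: "j < xs ! i" "hook_length xs i j = h" by blast
  let ?A = "{k. k < length xs \<and> j < xs ! k}"
  define c where "c = card ?A"
  have "?A = {..<c}"
    unfolding c_def
  proof (rule initial_segment)
    fix k l assume "l \<in> ?A" "k \<le> l"
    then show "k \<in> ?A" using part_antimono[OF xs, of k l] by (auto simp: part_at_def)
  qed auto
  note A = this
  note hl = hook_length_eq[OF xs i j(1) A]
  have "{..<c} \<subseteq> {..<length xs}" unfolding A[symmetric] by auto
  then have cN: "c \<le> N" using N by simp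
  have bh: "h \<le> b" "b - h = N + j - c" using hl j i N cN by (auto simp: b_def)
  have "N + j - c \<noteq> part_at xs k + (N - 1 - k)" if k: "k < N" for k
  proof (cases "k < c")
    case True
    then have "k \<in> ?A" using A by simp
    then show ?thesis using True k cN by (auto simp: part_at_def)
  next
    case False
    then have "k \<notin> ?A" using A by simp
    then have "part_at xs k \<le> j" by (auto simp: part_at_def)
    then show ?thesis using False k cN by linarith
  qed
  then show "h \<le> b \<and> b - h \<notin> beta_set N xs" using bh by (auto simp: beta_set_def)
next
  assume *: "h \<le> b \<and> b - h \<notin> beta_set N xs"
  define y where "y = b - h"
  let ?b = "\<lambda>k. part_at xs k + (N - 1 - k)"
  have y: "y < b" "\<And>k. k < N \<Longrightarrow> ?b k \<noteq> y"
  proof -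
    show "y < b" using * h by (simp add: y_def)
    show "?b k \<noteq> y" if "k < N" for k
    proof -
      have "?b k \<in> beta_set N xs" unfolding beta_set_def using that by blast
      then show ?thesis using * by (auto simp: y_def)
    qed
  qed
  let ?K = "{k. k < N \<and> y < ?b k}"
  define k0 where "k0 = card ?K"
  have K: "?K = {..<k0}"
    unfolding k0_def
  proof (rule initial_segment)
    fix k l assume "l \<in> ?K" "k \<le> l"
    then show "k \<in> ?K" using beta_strict[OF xs, of k l N] by (cases "k = l") auto
  qed auto
  have iK: "i < k0" using K y i N by (auto simp: b_def part_at_def)
  have "{..<k0} \<subseteq> {..<N}" unfolding K[symmetric] by auto
  then have k0N: "k0 \<le> N" by simp
  have "?b ` {k0..<N} \<subseteq> {..<y}"
  proof safe
    fix k assume "k \<in> {k0..<N}"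
    then have "k \<notin> ?K" "k < N" unfolding K by simp_all
    then show "?b k < y" using y(2)[of k] by simp
  qed
  moreover have "inj_on ?b {k0..<N}"
  proof (rule linorder_inj_onI)
    fix k l assume "k < l" "k \<in> {k0..<N}" "l \<in> {k0..<N}"
    then show "?b k \<noteq> ?b l" using beta_strict[OF xs, of k l N] by simp
  qed auto
  ultimately have "card {k0..<N} \<le> card {..<y}"
    using card_inj_on_le[of ?b "{k0..<N}" "{..<y}"] by simp
  then have yN: "N \<le> y + k0" by simp
  \<comment> \<open>The gap \<open>y\<close> has the form \<open>N + j - k0\<close>, where \<open>k0\<close> will be the length of column \<open>j\<close>.\<close>
  define j where "j = y + k0 - N"
  have large: "j < part_at xs k" if "k < k0" for k
  proof -
    have "k0 - 1 \<in> ?K" unfolding K using iK by simp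
    then have "y < ?b (k0 - 1)" by blast
    then have "j < part_at xs (k0 - 1)" using iK k0N yN unfolding j_def by linarith
    moreover have "k \<le> k0 - 1" using that by simp
    ultimately show ?thesis using part_antimono[OF xs] less_le_trans by blast
  qed
  have small: "part_at xs k \<le> j" if "k0 \<le> k" "k < N" for k
  proof -
    have "k0 \<notin> ?K" unfolding K by simp
    moreover have "k0 < N" using that by simp
    ultimately have "?b k0 < y" using y(2)[of k0] by simp
    then have "part_at xs k0 \<le> j" using \<open>k0 < N\<close> yN unfolding j_def by linarith
    then show ?thesis using part_antimono[OF xs that(1)] by simp
  qed
  have A: "{k. k < length xs \<and> j < xs ! k} = {..<k0}"
  proof safe
    fix k assume k: "k < length xs" "j < xs ! k"
    show "k < k0"
    proof (rule ccontr)
      assume "\<not> k < k0"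
      then have "part_at xs k \<le> j" using small[of k] k N by simp
      then show False using k by (simp add: part_at_def)
    qed
  next
    fix k assume "k < k0"
    then have "j < part_at xs k" by (rule large)
    then show "k < length xs" "j < xs ! k" by (simp_all add: part_at_def split: if_splits)
  qed
  have j: "j < xs ! i" using large[OF iK] i by (simp add: part_at_def)
  have "hook_length xs i j = h"
    using hook_length_eq(1)[OF xs i j A] iK k0N yN * j i N by (auto simp: j_def y_def b_def)
  then show "\<exists>j<xs ! i. hook_length xs i j = h" using j by blast
qed

lemma t_closed_iterate:
  assumes "t_closed t X" "x \<in> X" "t * m \<le> x"
  shows "x - t * m \<in> X"
  using assms(3)
proof (induction m)
  case (Suc m)
  then have "x - t * m \<in> X" "t \<le> x - t * m" by auto
  then have "x - t * m - t \<in> X" using assms(1) by (auto simp: t_closed_def)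
  then show ?case by (simp add: add.commute)
qed (use assms in simp)

text \<open>
By \<open>hook_iff_gap\<close> a hook length divisible by \<open>t\<close> is a difference between an element of the beta-set and a smaller number
outside. Going down from that element in steps of \<open>t\<close>, one leaves the beta-set at some step.
\<close>
lemma is_core_iff_t_closed:
  assumes xs: "is_partition xs" and N: "length xs \<le> N" and t: "t > 0"
  shows "is_core t xs \<longleftrightarrow> t_closed t (beta_set N xs)"
proof
  assume core: "is_core t xs"
  show "t_closed t (beta_set N xs)"
    unfolding t_closed_def
  proof (intro ballI impI)
    fix x assume x: "x \<in> beta_set N xs" "t \<le> x"
    then obtain i where i: "i < N" "x = part_at xs i + (N - 1 - i)" by (auto simp: beta_set_def)
    show "x - t \<in> beta_set N xs"
    proof (cases "i < length xs")
      case True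
      have "\<not> (\<exists>j<xs ! i. hook_length xs i j = t)"
      proof
        assume "\<exists>j<xs ! i. hook_length xs i j = t"
        then obtain j where "(i, j) \<in> young_diagram xs" "t dvd hook_length xs i j"
          using True by (auto simp: young_diagram_def)
        then show False using core by (auto simp: is_core_def)
      qed
      then show ?thesis using hook_iff_gap[OF xs N True t] x i True by (simp add: part_at_def)
    next
      case False
      then have "x - t = part_at xs (i + t) + (N - 1 - (i + t))" "i + t < N"
        using i x t by (auto simp: part_at_def)
      then show ?thesis unfolding beta_set_def by (intro image_eqI) auto
    qed
  qed
next
  assume cl: "t_closed t (beta_set N xs)"
  show "is_core t xs"
    unfolding is_core_def
  proof safe
    fix i j assume ij: "(i, j) \<in> young_diagram xs" "t dvd hook_length xs i j"
    then have i: "i < length xs" "j < xs ! i" by (auto simp: young_diagram_def)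
    obtain m where m: "hook_length xs i j = t * m" using ij by blast
    have pos: "t * m > 0" unfolding m[symmetric] by (simp add: hook_length_def)
    let ?b = "xs ! i + (N - 1 - i)"
    have "t * m \<le> ?b" "?b - t * m \<notin> beta_set N xs"
      using hook_iff_gap[OF xs N i(1) pos] i m by blast+
    moreover have "?b \<in> beta_set N xs"
      using i N unfolding beta_set_def by (intro image_eqI[of _ _ i]) (auto simp: part_at_def)
    ultimately show False using t_closed_iterate[OF cl] by blast
  qed
qed

lemma beta_set_Suc:
  "beta_set (Suc N) xs = insert (part_at xs 0 + N) (beta_set N (tl xs))"
proof -
  have "{..<Suc N} = insert 0 (Suc ` {..<N})" by (simp add: lessThan_Suc_eq_insert_0)
  moreover have "part_at (tl xs) i = part_at xs (Suc i)" for i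
    by (auto simp: part_at_def nth_tl)
  ultimately show ?thesis by (simp add: beta_set_def image_image)
qed

lemma is_partition_tl: "is_partition xs \<Longrightarrow> is_partition (tl xs)"
  by (cases xs) (auto simp: is_partition_def)

lemma beta_set_tl_less:
  assumes "is_partition xs" "x \<in> beta_set N (tl xs)"
  shows "x < part_at xs 0 + N"
proof -
  obtain i where i: "i < N" "x = part_at (tl xs) i + (N - 1 - i)"
    using assms(2) by (auto simp: beta_set_def)
  have "part_at (tl xs) i = part_at xs (Suc i)" by (auto simp: part_at_def nth_tl)
  then show ?thesis using part_antimono[OF assms(1), of 0 "Suc i"] i by simp
qed

lemma finite_beta_set [simp]: "finite (beta_set N xs)"
  by (simp add: beta_set_def)

lemma card_sum_beta_set:
  assumes "is_partition xs" "length xs \<le> N"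
  shows "card (beta_set N xs) = N \<and> \<Sum>(beta_set N xs) = sum_list xs + (N choose 2)"
  using assms
proof (induction N arbitrary: xs)
  case 0
  then show ?case by (simp add: beta_set_def)
next
  case (Suc N)
  have "part_at xs 0 + N \<notin> beta_set N (tl xs)" using beta_set_tl_less[OF Suc.prems(1)] by blast
  moreover have "sum_list xs = part_at xs 0 + sum_list (tl xs)" by (cases xs) (auto simp: part_at_def)
  ultimately show ?case
    using Suc.IH[OF is_partition_tl[OF Suc.prems(1)]] Suc.prems
    by (simp add: beta_set_Suc numeral_2_eq_2)
qed

lemma beta_set_inj:
  assumes "is_partition xs" "length xs \<le> N" "is_partition ys" "length ys \<le> N"
    "beta_set N xs = beta_set N ys"
  shows "xs = ys"
  using assms
proof (induction N arbitrary: xs ys)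
  case (Suc N)
  have M: "Max (beta_set (Suc N) zs) = part_at zs 0 + N \<and> beta_set N (tl zs) = beta_set (Suc N) zs - {part_at zs 0 + N}"
    if "is_partition zs" for zs
  proof
    note less = beta_set_tl_less[OF that]
    show "Max (beta_set (Suc N) zs) = part_at zs 0 + N"
    proof (rule Max_eqI)
      fix y assume "y \<in> beta_set (Suc N) zs"
      then show "y \<le> part_at zs 0 + N" using less[of y N] unfolding beta_set_Suc by auto
    qed (simp_all add: beta_set_Suc)
    have "part_at zs 0 + N \<notin> beta_set N (tl zs)" using less by blast
    then show "beta_set N (tl zs) = beta_set (Suc N) zs - {part_at zs 0 + N}"
      unfolding beta_set_Suc by simp
  qed
  have p: "part_at xs 0 = part_at ys 0" using M[OF Suc.prems(1)] M[OF Suc.prems(3)] Suc.prems(5) by simp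
  then have "beta_set N (tl xs) = beta_set N (tl ys)"
    using M[OF Suc.prems(1)] M[OF Suc.prems(3)] Suc.prems(5) by simp
  then have "tl xs = tl ys"
    using Suc.prems by (intro Suc.IH is_partition_tl) auto
  moreover have "xs = [] \<longleftrightarrow> ys = []"
    using p Suc.prems(1,3) by (cases xs; cases ys) (simp_all add: part_at_def is_partition_def)
  ultimately show ?case using p by (cases xs; cases ys) (simp_all add: part_at_def)
qed simp

text \<open>
Induction on \<open>N\<close>: the largest element determines the first part, and the other elements form the beta-set of
the remaining parts.
\<close>
lemma beta_set_surj:
  assumes "finite X" "card X = N"
  shows "\<exists>xs. is_partition xs \<and> length xs \<le> N \<and> beta_set N xs = X"
  using assms
proof (induction N arbitrary: X)
  case 0
  then show ?case by (intro exI[of _ "[]"]) (auto simp: is_partition_def beta_set_def)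
next
  case (Suc N)
  define M where "M = Max X"
  have ne: "X \<noteq> {}" using Suc.prems by auto
  have MX: "M \<in> X" "\<And>x. x \<in> X \<Longrightarrow> x \<le> M"
    using Max_in[OF Suc.prems(1) ne] Suc.prems(1) by (auto simp: M_def)
  obtain ys where ys: "is_partition ys" "length ys \<le> N" "beta_set N ys = X - {M}"
    using Suc.IH[of "X - {M}"] Suc.prems MX by auto
  have "X \<subseteq> {..M}" using MX by auto
  then have "Suc N \<le> Suc M" using card_mono[of "{..M}" X] Suc.prems by simp
  then have NM: "N \<le> M" by simp
  show ?case
  proof (cases "M = N")
    case True
    have "X = {..N}" using \<open>X \<subseteq> {..M}\<close> True Suc.prems
      by (intro card_subset_eq) auto
    moreover have "beta_set (Suc N) [] = {..N}"
    proof -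
      have "x \<in> (\<lambda>i. N - i) ` {..<Suc N}" if "x \<le> N" for x
        using that by (intro image_eqI[of _ _ "N - x"]) auto
      then show ?thesis by (auto simp: beta_set_def part_at_def)
    qed
    moreover have "is_partition []" by (simp add: is_partition_def)
    ultimately show ?thesis by (intro exI[of _ "[]"]) simp
  next
    case False
    define xs where "xs = (M - N) # ys"
    have "y \<le> M - N" if yin: "y \<in> set ys" for y
    proof -
      have N0: "N > 0" using length_pos_if_in_set[OF yin] ys(2) by linarith
      obtain i where "i < length ys" "y = ys ! i" using yin by (auto simp: in_set_conv_nth)
      then have "ys ! 0 \<ge> y" using part_antimono[OF ys(1), of 0 i] by (simp add: part_at_def split: if_splits)
      moreover have "ys ! 0 + (N - 1) \<in> beta_set N ys"
        unfolding beta_set_def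
        by (rule image_eqI[of _ _ 0]) (use N0 length_pos_if_in_set[OF yin] in \<open>simp_all add: part_at_def\<close>)
      then have "ys ! 0 + (N - 1) \<in> X" "ys ! 0 + (N - 1) \<noteq> M" using ys(3) by auto
      then have "ys ! 0 + (N - 1) < M" using MX(2) by (meson le_neq_implies_less)
      ultimately show ?thesis using N0 by linarith
    qed
    then have "is_partition xs" using ys(1) False NM by (auto simp: xs_def is_partition_def)
    moreover have "beta_set (Suc N) xs = X"
      using MX(1) NM unfolding beta_set_Suc xs_def by (simp add: ys(3) part_at_def insert_absorb)
    moreover have "length xs \<le> Suc N" using ys(2) by (simp add: xs_def)
    ultimately show ?thesis by blast
  qed
qed

text \<open>
In the picture of an abacus, the number of beads on runner \<open>r\<close>.
\<close>
definition beads :: "nat \<Rightarrow> nat set \<Rightarrow> nat" where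
  "beads r X = card {x \<in> X. x mod 3 = r}"

lemma t_closed_beads:
  assumes "finite X" "t_closed 3 X" "r < 3"
  shows "{x \<in> X. x mod 3 = r} = (\<lambda>k. 3 * k + r) ` {..<beads r X}"
proof -
  let ?A = "{k. 3 * k + r \<in> X}"
  have eq: "{x \<in> X. x mod 3 = r} = (\<lambda>k. 3 * k + r) ` ?A"
  proof safe
    fix x assume "x \<in> X" "r = x mod 3"
    then show "x \<in> (\<lambda>k. 3 * k + x mod 3) ` {k. 3 * k + x mod 3 \<in> X}"
      by (intro image_eqI[of _ _ "x div 3"]) auto
  qed (use assms in auto)
  have inj: "inj_on (\<lambda>k. 3 * k + r) ?A" by (auto simp: inj_on_def)
  have fin: "finite ?A"
    by (rule finite_imageD[OF _ inj]) (use assms(1) in \<open>simp flip: eq\<close>)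
  have "?A = {..<card ?A}"
  proof (rule initial_segment[OF fin])
    fix i j assume "j \<in> ?A" "i \<le> j"
    then show "i \<in> ?A"
      using t_closed_iterate[OF assms(2), of "3 * j + r" "j - i"] by (auto simp: diff_mult_distrib2 add.commute)
  qed
  moreover have "card ?A = beads r X" unfolding beads_def eq by (simp add: card_image[OF inj])
  ultimately show ?thesis using eq by simp
qed

lemma mod3_Un: "X = {x \<in> X. x mod 3 = 0} \<union> ({x \<in> X. x mod 3 = 1} \<union> {x \<in> X. x mod 3 = (2::nat)})"
  by auto

lemma sum_mod3:
  fixes f :: "nat \<Rightarrow> nat"
  assumes "finite X"
  shows "sum f X = sum f {x \<in> X. x mod 3 = 0} + sum f {x \<in> X. x mod 3 = 1} + sum f {x \<in> X. x mod 3 = 2}"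
proof -
  let ?X = "\<lambda>r. {x \<in> X. x mod 3 = r}"
  have "sum f X = sum f (?X 0 \<union> (?X 1 \<union> ?X 2))" using mod3_Un[of X] by simp
  also have "\<dots> = sum f (?X 0) + sum f (?X 1 \<union> ?X 2)"
    by (rule sum.union_disjoint) (use assms in auto)
  also have "sum f (?X 1 \<union> ?X 2) = sum f (?X 1) + sum f (?X 2)"
    by (rule sum.union_disjoint) (use assms in auto)
  finally show ?thesis by simp
qed

lemma beads_sum:
  assumes "finite X"
  shows "beads 0 X + beads 1 X + beads 2 X = card X"
  using sum_mod3[OF assms, of "\<lambda>_. 1"] by (simp add: beads_def)

lemma sum_arith: "(\<Sum>k<n. 3 * k + r) = r * n + 3 * (n choose 2)"
  by (induction n) (auto simp: numeral_2_eq_2)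

lemma t_closed_sum:
  assumes "finite X" "t_closed 3 X"
  shows "\<Sum>X = beads 1 X + 2 * beads 2 X
    + 3 * ((beads 0 X choose 2) + (beads 1 X choose 2) + (beads 2 X choose 2))"
proof -
  have s: "\<Sum>{x \<in> X. x mod 3 = r} = r * beads r X + 3 * (beads r X choose 2)" if "r < 3" for r
    unfolding t_closed_beads[OF assms that] by (subst sum.reindex) (auto simp: inj_on_def sum_arith)
  have "\<Sum>X = \<Sum>{x \<in> X. x mod 3 = 0} + \<Sum>{x \<in> X. x mod 3 = 1} + \<Sum>{x \<in> X. x mod 3 = 2}"
    by (rule sum_mod3[OF assms(1)])
  then show ?thesis using s[of 0] s[of 1] s[of 2] by simp
qed

definition cores :: "nat list set" where
  "cores = {xs. is_partition xs \<and> is_core 3 xs}"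

definition bead_counts :: "nat \<Rightarrow> nat list \<Rightarrow> nat \<times> nat \<times> nat" where
  "bead_counts N xs = (beads 0 (beta_set N xs), beads 1 (beta_set N xs), beads 2 (beta_set N xs))"

text \<open>
On each runner of the abacus of a 3-core the beads are pushed to the bottom, so only their numbers matter, and these
are arbitrary.
\<close>
lemma bij_betw_bead_counts: "bij_betw (bead_counts N) {xs \<in> cores. length xs \<le> N} (triples N)"
proof (rule bij_betwI')
  fix xs ys assume xy: "xs \<in> {xs \<in> cores. length xs \<le> N}" "ys \<in> {xs \<in> cores. length xs \<le> N}"
  have cl: "t_closed 3 (beta_set N zs)" if "zs \<in> {xs \<in> cores. length xs \<le> N}" for zs
    using that is_core_iff_t_closed[of zs N 3] by (auto simp: cores_def)
  show "(bead_counts N xs = bead_counts N ys) = (xs = ys)"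
  proof
    assume "bead_counts N xs = bead_counts N ys"
    then have "beads r (beta_set N xs) = beads r (beta_set N ys)" if "r < 3" for r
      using that by (auto simp: bead_counts_def less_Suc_eq numeral_3_eq_3 numeral_2_eq_2)
    then have "{x \<in> beta_set N xs. x mod 3 = r} = {x \<in> beta_set N ys. x mod 3 = r}" if "r < 3" for r
      using that t_closed_beads[OF _ cl] xy by simp
    then have "beta_set N xs = beta_set N ys"
      using mod3_Un[of "beta_set N xs"] mod3_Un[of "beta_set N ys"] by simp
    then show "xs = ys" using xy beta_set_inj[of xs N ys] by (auto simp: cores_def)
  qed simp
next
  fix xs assume "xs \<in> {xs \<in> cores. length xs \<le> N}"
  then show "bead_counts N xs \<in> triples N"
    using beads_sum[of "beta_set N xs"] card_sum_beta_set[of xs N]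
    by (auto simp: bead_counts_def triples_def cores_def)
next
  fix z assume "z \<in> triples N"
  then obtain a b c where z: "z = (a, b, c)" "a + b + c = N" by (auto simp: triples_def)
  define A where "A r n = (\<lambda>k. 3 * k + r) ` {..<n}" for r n :: nat
  define X where "X = A 0 a \<union> A 1 b \<union> A 2 c"
  have A: "{x \<in> A r n. x mod 3 = s} = (if r = s then A r n else {})" if "r < 3" "s < 3" for r s n
    using that by (auto simp: A_def)
  have cA: "card (A r n) = n" for r n unfolding A_def by (subst card_image) (auto simp: inj_on_def)
  have fX: "finite X" by (auto simp: X_def A_def)
  have U: "{x \<in> X. x mod 3 = s} = {x \<in> A 0 a. x mod 3 = s} \<union> {x \<in> A 1 b. x mod 3 = s} \<union> {x \<in> A 2 c. x mod 3 = s}" for s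
    by (auto simp: X_def)
  have r: "beads 0 X = a" "beads 1 X = b" "beads 2 X = c"
    unfolding beads_def U by (simp_all add: A cA)
  have "t_closed 3 X"
    unfolding t_closed_def
  proof (intro ballI impI)
    fix x assume "x \<in> X" "3 \<le> x"
    have "y - 3 \<in> A r n" if y: "y \<in> A r n" "3 \<le> y" "r < 3" for y r n
    proof -
      obtain k where "y = 3 * k + r" "k < n" using y(1) by (auto simp: A_def)
      then have "y - 3 = 3 * (k - 1) + r" "k - 1 < n" using y(2,3) by auto
      then show ?thesis by (auto simp: A_def)
    qed
    then show "x - 3 \<in> X" using \<open>x \<in> X\<close> \<open>3 \<le> x\<close> by (auto simp: X_def)
  qed
  moreover have "card X = N" using beads_sum[OF fX] r z by simp
  then obtain xs where xs: "is_partition xs" "length xs \<le> N" "beta_set N xs = X"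
    using beta_set_surj[OF fX] by blast
  ultimately show "\<exists>xs\<in>{xs \<in> cores. length xs \<le> N}. z = bead_counts N xs"
    using is_core_iff_t_closed[OF xs(1,2), of 3] r z
    by (intro bexI[of _ xs]) (auto simp: bead_counts_def cores_def)
qed

lemma bead_counts_size:
  assumes "xs \<in> cores" "length xs \<le> N" "bead_counts N xs = (a, b, c)"
  shows "b + 2 * c + 3 * ((a choose 2) + (b choose 2) + (c choose 2)) = sum_list xs + (N choose 2)"
  using t_closed_sum[of "beta_set N xs"] card_sum_beta_set[of xs N] is_core_iff_t_closed[of xs N 3] assms
  by (auto simp: bead_counts_def cores_def)

text \<open>
The zeros that are added to the partition put beads on all numbers below \<open>N - length xs\<close>.
\<close>
lemma beads_lower:
  assumes "length xs \<le> N" "r < 3"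
  shows "(N - length xs) div 3 \<le> beads r (beta_set N xs)"
proof -
  have "(\<lambda>k. 3 * k + r) ` {..<(N - length xs) div 3} \<subseteq> {x \<in> beta_set N xs. x mod 3 = r}"
  proof safe
    fix k assume "k < (N - length xs) div 3"
    then have "3 * k + r < N - length xs" using assms(2) by linarith
    then show "3 * k + r \<in> beta_set N xs"
      unfolding beta_set_def by (intro image_eqI[of _ _ "N - 1 - (3 * k + r)"]) (auto simp: part_at_def)
  qed (use assms in auto)
  then have "card ((\<lambda>k. 3 * k + r) ` {..<(N - length xs) div 3}) \<le> beads r (beta_set N xs)"
    unfolding beads_def by (intro card_mono) auto
  moreover have "card ((\<lambda>k. 3 * k + r) ` {..<(N - length xs) div 3}) = (N - length xs) div 3"
    by (subst card_image) (auto simp: inj_on_def)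
  ultimately show ?thesis by simp
qed

section \<open>Counting tuples of 3-cores and comparing coefficients\<close>

lemma qpoch_tendsto:
  assumes "0 < y" "y < 1"
  shows "qpoch y \<longlonglongrightarrow> exp (eval_log y)"
  using has_prod_imp_tendsto'[OF euler_product[OF assms]] by (simp add: qpoch_def[abs_def])

lemma qpoch_ge:
  assumes y: "0 < y" "y < 1"
  shows "exp (eval_log y) \<le> qpoch y N"
proof (rule decseq_ge[OF _ qpoch_tendsto[OF y]])
  show "decseq (qpoch y)"
  proof (rule decseq_SucI)
    fix n
    have "qpoch y (Suc n) = qpoch y n * (1 - y ^ Suc n)" by (simp add: qpoch_def)
    also have "\<dots> \<le> qpoch y n * 1"
      using qpoch_pos[OF y, of n] y by (intro mult_left_mono) auto
    finally show "qpoch y (Suc n) \<le> qpoch y n" by simp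
  qed
qed

definition core_weight :: "real \<Rightarrow> nat \<Rightarrow> nat list \<Rightarrow> real" where
  "core_weight y N xs = (case bead_counts N xs of (a, b, c) \<Rightarrow> 1 / (qpoch y a * qpoch y b * qpoch y c))"

lemma finite_cores_length: "finite {xs \<in> cores. length xs \<le> N}"
proof -
  have "triples N \<subseteq> {..N} \<times> {..N} \<times> {..N}" by (auto simp: triples_def)
  then have "finite (triples N)" by (rule finite_subset) simp
  then show ?thesis using bij_betw_finite[OF bij_betw_bead_counts] by blast
qed

text \<open>
By \<open>bead_counts_size\<close> the power of \<open>q\<close> in the term of \<open>finite_trisection\<close> that belongs to a core is the size of the core,
apart from a common factor.
\<close>
lemma core_sum_finite:
  assumes q: "0 < q" "q < 1"
  shows "1 / qpoch q N = (\<Sum>xs | xs \<in> cores \<and> length xs \<le> N. q ^ sum_list xs * core_weight (q ^ 3) N xs)"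
proof -
  let ?t = "\<lambda>(a, b, c). q ^ (b + 2 * c + 3 * ((a choose 2) + (b choose 2) + (c choose 2))) /
    (qpoch (q ^ 3) a * qpoch (q ^ 3) b * qpoch (q ^ 3) c)"
  have "q ^ (N choose 2) / qpoch q N = (\<Sum>xs | xs \<in> cores \<and> length xs \<le> N. ?t (bead_counts N xs))"
    unfolding finite_trisection[OF q] by (rule sum.reindex_bij_betw[OF bij_betw_bead_counts, symmetric])
  also have "\<dots> = (\<Sum>xs | xs \<in> cores \<and> length xs \<le> N. q ^ (N choose 2) * (q ^ sum_list xs * core_weight (q ^ 3) N xs))"
  proof (rule sum.cong)
    fix xs assume xs: "xs \<in> {xs. xs \<in> cores \<and> length xs \<le> N}"
    obtain a b c where abc: "bead_counts N xs = (a, b, c)" by (cases "bead_counts N xs") auto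
    have "b + 2 * c + 3 * ((a choose 2) + (b choose 2) + (c choose 2)) = sum_list xs + (N choose 2)"
      using bead_counts_size[OF _ _ abc] xs by blast
    then have "q ^ (b + 2 * c + 3 * ((a choose 2) + (b choose 2) + (c choose 2))) = q ^ (N choose 2) * q ^ sum_list xs"
      by (simp only: power_add mult.commute)
    then show "?t (bead_counts N xs) = q ^ (N choose 2) * (q ^ sum_list xs * core_weight (q ^ 3) N xs)"
      by (simp only: abc core_weight_def prod.case) simp
  qed simp
  also have "\<dots> = q ^ (N choose 2) * (\<Sum>xs | xs \<in> cores \<and> length xs \<le> N. q ^ sum_list xs * core_weight (q ^ 3) N xs)"
    by (simp only: sum_distrib_left)
  finally have "q ^ (N choose 2) * (1 / qpoch q N)
    = q ^ (N choose 2) * (\<Sum>xs | xs \<in> cores \<and> length xs \<le> N. q ^ sum_list xs * core_weight (q ^ 3) N xs)" by simp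
  then show ?thesis using q by (subst (asm) mult_cancel_left) auto
qed

lemma core_weight_tendsto:
  assumes y: "0 < y" "y < 1"
  shows "(\<lambda>N. core_weight y N xs) \<longlonglongrightarrow> 1 / exp (eval_log y) ^ 3"
proof -
  have "filterlim (\<lambda>N. beads r (beta_set N xs)) at_top sequentially" if "r < 3" for r
  proof (rule filterlim_at_top_mono)
    show "filterlim (\<lambda>N. (N - length xs) div 3) at_top sequentially"
      unfolding filterlim_at_top
    proof
      fix Z show "\<forall>\<^sub>F N in sequentially. Z \<le> (N - length xs) div 3"
        using eventually_ge_at_top[of "3 * Z + length xs"] by eventually_elim linarith
    qed
    show "\<forall>\<^sub>F N in sequentially. (N - length xs) div 3 \<le> beads r (beta_set N xs)"
      using eventually_ge_at_top[of "length xs"] by eventually_elim (use beads_lower that in blast)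
  qed
  then have "(\<lambda>N. qpoch y (beads r (beta_set N xs))) \<longlonglongrightarrow> exp (eval_log y)" if "r < 3" for r
    using filterlim_compose[OF qpoch_tendsto[OF y]] that by blast
  then have "(\<lambda>N. 1 / (qpoch y (beads 0 (beta_set N xs)) * qpoch y (beads 1 (beta_set N xs)) * qpoch y (beads 2 (beta_set N xs))))
    \<longlonglongrightarrow> 1 / (exp (eval_log y) * exp (eval_log y) * exp (eval_log y))"
    by (intro tendsto_intros) auto
  then show ?thesis by (simp add: core_weight_def bead_counts_def power3_eq_cube mult.assoc)
qed

lemma core_weight_bounds:
  assumes y: "0 < y" "y < 1"
  shows "0 \<le> core_weight y N xs" "core_weight y N xs \<le> 1 / exp (eval_log y) ^ 3"
proof -
  obtain a b c where abc: "bead_counts N xs = (a, b, c)" by (cases "bead_counts N xs") auto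
  note pos = qpoch_pos[OF y] and ge = qpoch_ge[OF y]
  show "0 \<le> core_weight y N xs" using pos[of a] pos[of b] pos[of c] by (simp add: core_weight_def abc)
  have "exp (eval_log y) * exp (eval_log y) * exp (eval_log y) \<le> qpoch y a * qpoch y b * qpoch y c"
    using pos[of a] pos[of b] pos[of c] by (intro mult_mono ge) auto
  then show "core_weight y N xs \<le> 1 / exp (eval_log y) ^ 3"
    by (simp add: core_weight_def abc power3_eq_cube mult.assoc frac_le)
qed

text \<open>
As \<open>N\<close> grows, the weights in \<open>core_sum_finite\<close> tend to a common limit, which is also an upper bound for them. The limit of a
finite part of the sum gives one inequality (and summability), the upper bound the other one.
\<close>
lemma has_sum_cores:
  assumes q: "0 < q" "q < 1"
  shows "((\<lambda>xs. q ^ sum_list xs) has_sum exp (eval_log (q ^ 3)) ^ 3 / exp (eval_log q)) cores"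
proof -
  have q3: "0 < q ^ 3" "q ^ 3 < 1" using q by (auto simp: power_less_one_iff)
  define P1 P3 where "P1 = exp (eval_log q)" and "P3 = exp (eval_log (q ^ 3)) ^ 3"
  have P: "P1 > 0" "P3 > 0" by (auto simp: P1_def P3_def)
  have L: "(\<lambda>N. 1 / qpoch q N) \<longlonglongrightarrow> 1 / P1"
    using P by (intro tendsto_divide tendsto_const) (auto simp: P1_def intro: qpoch_tendsto[OF q])
  have upper: "(\<Sum>xs\<in>F. q ^ sum_list xs) \<le> P3 / P1" if F: "finite F" "F \<subseteq> cores" for F
  proof -
    have "(\<lambda>N. \<Sum>xs\<in>F. q ^ sum_list xs * core_weight (q ^ 3) N xs) \<longlonglongrightarrow> (\<Sum>xs\<in>F. q ^ sum_list xs * (1 / P3))"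
      unfolding P3_def by (intro tendsto_sum tendsto_mult tendsto_const core_weight_tendsto q3)
    then have "(\<Sum>xs\<in>F. q ^ sum_list xs * (1 / P3)) \<le> 1 / P1"
    proof (rule LIMSEQ_le[OF _ L])
      show "\<exists>M. \<forall>N\<ge>M. (\<Sum>xs\<in>F. q ^ sum_list xs * core_weight (q ^ 3) N xs) \<le> 1 / qpoch q N"
    proof (intro exI allI impI)
      fix N assume N: "(\<Sum>xs\<in>F. length xs) \<le> N"
      have "length xs \<le> N" if "xs \<in> F" for xs
        using member_le_sum[OF that, of length] F N by simp
      then have "F \<subseteq> {xs. xs \<in> cores \<and> length xs \<le> N}" using F by auto
      then show "(\<Sum>xs\<in>F. q ^ sum_list xs * core_weight (q ^ 3) N xs) \<le> 1 / qpoch q N"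
        unfolding core_sum_finite[OF q]
        using finite_cores_length core_weight_bounds(1)[OF q3] q
        by (intro sum_mono2) auto
    qed
    qed
    then have "(\<Sum>xs\<in>F. q ^ sum_list xs) / P3 \<le> 1 / P1" by (simp add: sum_divide_distrib)
    then show ?thesis using P by (simp add: field_simps)
  qed
  have summ: "(\<lambda>xs. q ^ sum_list xs) summable_on cores"
  proof (rule nonneg_bdd_above_summable_on)
    show "bdd_above (sum (\<lambda>xs. q ^ sum_list xs) ` {F. F \<subseteq> cores \<and> finite F})"
      using upper by (intro bdd_aboveI2[of _ _ "P3 / P1"]) auto
  qed (use q in auto)
  let ?I = "infsum (\<lambda>xs. q ^ sum_list xs) cores"
  have "?I \<le> P3 / P1" by (rule infsum_le_finite_sums[OF summ upper])
  moreover have "P3 / P1 \<le> ?I"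
  proof -
    have "1 / qpoch q N \<le> ?I / P3" for N
    proof -
      let ?C = "{xs. xs \<in> cores \<and> length xs \<le> N}"
      have "1 / qpoch q N \<le> (\<Sum>xs\<in>?C. q ^ sum_list xs * (1 / P3))"
        unfolding core_sum_finite[OF q] P3_def using q
        by (intro sum_mono mult_left_mono core_weight_bounds q3) auto
      also have "\<dots> = (\<Sum>xs\<in>?C. q ^ sum_list xs) / P3" by (simp add: sum_divide_distrib)
      also have "\<dots> \<le> ?I / P3"
        using P q finite_cores_length by (intro divide_right_mono finite_sum_le_infsum summ) auto
      finally show ?thesis .
    qed
    then have "1 / P1 \<le> ?I / P3" by (intro LIMSEQ_le_const2[OF L]) auto
    then show ?thesis using P by (simp add: field_simps)
  qed
  ultimately have "?I = P3 / P1" by simp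
  then show ?thesis using has_sum_infsum[OF summ] by (simp add: P1_def P3_def)
qed

definition core_count :: "nat \<Rightarrow> nat" where
  "core_count n = card {xs \<in> cores. sum_list xs = n}"

definition core_fps :: "real fps" where
  "core_fps = Abs_fps (\<lambda>n. real (core_count n))"

lemma finite_cores_sum: "finite {xs \<in> cores. sum_list xs = n}"
proof (rule finite_subset)
  show "{xs \<in> cores. sum_list xs = n} \<subseteq> hd ` partition_tuples 1 n"
  proof
    fix xs assume "xs \<in> {xs \<in> cores. sum_list xs = n}"
    then have "[xs] \<in> partition_tuples 1 n" by (auto simp: partition_tuples_def cores_def)
    then show "xs \<in> hd ` partition_tuples 1 n" by force
  qed
qed (simp add: finite_partition_tuples)

lemma core_fps_sums:
  assumes q: "0 < q" "q < 1"
  shows "(\<lambda>n. fps_nth core_fps n * q ^ n) sums (exp (eval_log (q ^ 3)) ^ 3 / exp (eval_log q))"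
proof -
  let ?S = "Sigma UNIV (\<lambda>n. {xs \<in> cores. sum_list xs = n})"
  have "((\<lambda>(n, xs). q ^ n) has_sum exp (eval_log (q ^ 3)) ^ 3 / exp (eval_log q)) ?S"
    by (rule has_sum_reindex_bij_witness[of _ snd "\<lambda>xs. (sum_list xs, xs)", THEN iffD1,
          OF _ _ _ _ _ _ has_sum_cores[OF q]]) auto
  then have "((\<lambda>n. fps_nth core_fps n * q ^ n) has_sum exp (eval_log (q ^ 3)) ^ 3 / exp (eval_log q)) UNIV"
  proof (rule has_sum_SigmaD)
    fix n
    show "((\<lambda>xs. case (n, xs) of (n, xs) \<Rightarrow> q ^ n) has_sum fps_nth core_fps n * q ^ n) {xs \<in> cores. sum_list xs = n}"
      using finite_cores_sum[of n] by (intro has_sum_finiteI) (auto simp: core_fps_def core_count_def)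
  qed
  then show ?thesis by (rule has_sum_imp_sums)
qed

lemma core_fps_conv_radius: "fps_conv_radius core_fps \<ge> 1"
  unfolding fps_conv_radius_def
proof (rule conv_radius_geI_ex)
  fix r :: real assume "0 < r" "ereal r < 1"
  then show "\<exists>z. norm z = r \<and> summable (\<lambda>n. fps_nth core_fps n * z ^ n)"
    using sums_summable[OF core_fps_sums[of r]] by (intro exI[of _ r]) auto
qed

lemma core_tuple_count_power: "fps_nth (core_fps ^ k) n = real (core_tuple_count 3 k n)"
proof (induction k arbitrary: n)
  case 0
  have "{ls \<in> partition_tuples 0 n. \<forall>xs\<in>set ls. is_core 3 xs} = (if n = 0 then {[]} else {})"
    by (auto simp: partition_tuples_def)
  then show ?case by (simp add: core_tuple_count_def)
next
  case (Suc k)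
  let ?T = "\<lambda>k n. {ls \<in> partition_tuples k n. \<forall>xs\<in>set ls. is_core 3 xs}"
  let ?C = "\<lambda>n. {xs \<in> cores. sum_list xs = n}"
  have "bij_betw (\<lambda>(i, xs, ls). xs # ls) (Sigma {0..n} (\<lambda>i. ?C i \<times> ?T k (n - i))) (?T (Suc k) n)"
    by (rule bij_betw_byWitness[where f' = "\<lambda>ls. (sum_list (hd ls), hd ls, tl ls)"])
      (auto simp: partition_tuples_def cores_def length_Suc_conv)
  then have "card (?T (Suc k) n) = card (Sigma {0..n} (\<lambda>i. ?C i \<times> ?T k (n - i)))"
    by (simp add: bij_betw_same_card)
  also have "\<dots> = (\<Sum>i=0..n. core_count i * core_tuple_count 3 k (n - i))"
    using finite_cores_sum finite_partition_tuples
    by (subst card_SigmaI) (auto simp: card_cartesian_product core_count_def core_tuple_count_def)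
  finally have "core_tuple_count 3 (Suc k) n = (\<Sum>i=0..n. core_count i * core_tuple_count 3 k (n - i))"
    by (simp only: core_tuple_count_def)
  moreover have "fps_nth core_fps i = real (core_count i)" for i by (simp add: core_fps_def)
  ultimately show ?case by (simp add: fps_mult_nth Suc.IH)
qed

text \<open>
If \<open>v\<close> is the multiplicity of 3 in \<open>n\<close>, then \<open>d \<mapsto> 3^v d\<close> maps the divisors of \<open>n\<close> prime to 3 to the divisors
whose complementary divisor is prime to 3.
\<close>
lemma sigma_sharp_eq:
  assumes n: "n > 0"
  shows "fps_nth (zeta3_fps 5) n = real (sigma_sharp_5_3 n)"
proof -
  define v where "v = multiplicity (3::nat) n"
  define m where "m = n div 3 ^ v"
  have nm: "n = 3 ^ v * m" by (simp add: m_def v_def multiplicity_dvd)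
  have m: "\<not> 3 dvd m" unfolding m_def v_def using n by (intro multiplicity_decompose) auto
  have "fps_nth (zeta3_fps 5) n = (\<Sum>d | d dvd n. if 3 dvd n div d then 0 else real d ^ 5)"
    unfolding zeta3_fps_def lambert_def fps_nth_Abs_fps
    by (intro sum.cong) (auto simp: chi3_def dvd_eq_mod_eq_0)
  also have "\<dots> = (\<Sum>d | d dvd n \<and> \<not> 3 dvd n div d. real d ^ 5)"
    using n by (intro sum.mono_neutral_cong_right) auto
  also have "\<dots> = (\<Sum>d | d dvd n \<and> \<not> 3 dvd d. real (3 ^ v * d) ^ 5)"
  proof (rule sum.reindex_bij_witness[of _ "\<lambda>d. 3 ^ v * d" "\<lambda>e. e div 3 ^ v"])
    fix e assume "e \<in> {d. d dvd n \<and> \<not> 3 dvd n div d}"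
    then have e: "e dvd n" "\<not> 3 dvd n div e" by auto
    have "coprime (3 ^ v) (n div e)" using e(2) by (intro coprime_power_left_iff[THEN iffD2] disjI1 prime_imp_coprime) auto
    moreover have "3 ^ v dvd e * (n div e)" using e(1) nm by simp
    ultimately have "3 ^ v dvd e" by (simp only: coprime_dvd_mult_left_iff)
    then obtain d where d: "e = 3 ^ v * d" by blast
    then have "d dvd m" using e(1) nm by simp
    then show "3 ^ v * (e div 3 ^ v) = e" "e div 3 ^ v \<in> {d. d dvd n \<and> \<not> 3 dvd d}"
      using d m nm by (auto dest: dvd_trans)
    show "real (3 ^ v * (e div 3 ^ v)) ^ 5 = real e ^ 5" using d by simp
  next
    fix d assume "d \<in> {d. d dvd n \<and> \<not> 3 dvd d}"
    then have d: "d dvd n" "\<not> 3 dvd d" by auto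
    show "3 ^ v * d div 3 ^ v = d" by simp
    have "coprime (3 ^ v) d" using d(2) by (intro coprime_power_left_iff[THEN iffD2] disjI1 prime_imp_coprime) auto
    then have "coprime d (3 ^ v)" by (simp only: coprime_commute[of d])
    then have "d dvd m" using d(1) unfolding nm by (simp only: coprime_dvd_mult_right_iff)
    then obtain k where k: "m = d * k" by blast
    have "d > 0" using d n by (auto intro!: Nat.gr0I)
    then have "n div (3 ^ v * d) = k" unfolding nm k by simp
    then show "3 ^ v * d \<in> {d. d dvd n \<and> \<not> 3 dvd n div d}"
      using nm k m by auto
  qed
  also have "\<dots> = 3 ^ (5 * v) * (\<Sum>d | d dvd n \<and> \<not> 3 dvd d. real d ^ 5)"
    by (simp add: power_mult_distrib sum_distrib_left mult.commute flip: power_mult)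
  also have "\<dots> = real (sigma_sharp_5_3 n)" by (simp add: sigma_sharp_5_3_def v_def)
  finally show ?thesis .
qed

text \<open>
The series converges in the unit disc, and a zero at 0 of a nonzero power series is isolated.
\<close>
lemma powser_real_unique:
  fixes G :: "nat \<Rightarrow> complex"
  assumes G0: "G 0 = 0" and sums: "\<And>q. 0 < q \<Longrightarrow> q < 1 \<Longrightarrow> (\<lambda>n. G n * of_real q ^ n) sums 0"
  shows "G n = 0"
proof (rule ccontr)
  assume "G n \<noteq> 0"
  then have n: "n > 0" using G0 by (auto intro: Nat.gr0I)
  have "summable (\<lambda>n. G n * of_real (1 / 2) ^ n)" using sums[of "1 / 2"] by (auto simp: sums_iff)
  then have "summable (\<lambda>n. G n * x ^ n)" if "norm x < 1 / 2" for x
    using powser_inside[of G "of_real (1 / 2)" x] that by (simp add: norm_divide)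
  then have sm: "(\<lambda>n. G n * (x - 0) ^ n) sums (\<Sum>n. G n * x ^ n)" if "norm (x - 0) < 1 / 2" for x
    using that by (simp add: summable_sums)
  have f0: "(\<Sum>n. G n * 0 ^ n) = 0" using G0 by simp
  obtain s where s: "0 < s" "\<And>z. z \<in> cball 0 s - {0} \<Longrightarrow> (\<Sum>n. G n * z ^ n) \<noteq> 0"
    using powser_0_nonzero[of "1 / 2" 0 G "\<lambda>x. \<Sum>n. G n * x ^ n" n, OF _ sm f0 \<open>G n \<noteq> 0\<close> n] by auto
  define q where "q = min s (1 / 2)"
  have q: "0 < q" "q < 1" "q \<le> s" using s(1) by (auto simp: q_def)
  have "(\<Sum>n. G n * of_real q ^ n) = 0" using sums[OF q(1,2)] by (simp add: sums_iff)
  moreover have "of_real q \<in> cball (0::complex) s - {0}" using q by simp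
  ultimately show False using s(2) by blast
qed

text \<open>
The purely imaginary \<open>\<tau>\<close> realize all real nomes between 0 and 1. The exponential prefactors of the eta functions
combine to \<open>q\<close> because \<open>6 / 24 + 3 * 6 / 24 = 1\<close>.
\<close>
lemma nome_eta_real:
  assumes q: "0 < q" "q < (1::real)"
  defines "\<tau> \<equiv> \<i> * of_real (- ln q / (2 * pi))"
  shows "Im \<tau> > 0" "nome \<tau> = of_real q"
    "dedekind_eta \<tau> ^ 6 * dedekind_eta (3 * \<tau>) ^ 6 = of_real (q * exp (eval_log q) ^ 6 * exp (eval_log (q ^ 3)) ^ 6)"
proof -
  have q3: "0 < q ^ 3" "q ^ 3 < 1" using q by (auto simp: power_less_one_iff)
  show "Im \<tau> > 0" using q by (simp add: \<tau>_def divide_neg_pos)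
  have e: "2 * of_real pi * \<i> * \<tau> = of_real (ln q)"
    by (simp add: \<tau>_def field_simps)
  show n1: "nome \<tau> = of_real q" unfolding nome_def e using q by (simp add: exp_of_real)
  have n3: "nome (3 * \<tau>) = of_real (q ^ 3)"
  proof -
    have "nome (3 * \<tau>) = exp (3 * (2 * of_real pi * \<i> * \<tau>))" by (simp add: nome_def mult_ac)
    also have "\<dots> = nome \<tau> ^ 3" using exp_of_nat_mult[of 3 "2 * of_real pi * \<i> * \<tau>"] by (simp add: nome_def)
    finally show ?thesis by (simp add: n1)
  qed
  have prod: "(\<Prod>m. 1 - of_real y ^ Suc m) = (of_real (exp (eval_log y)) :: complex)" if "0 < y" "y < 1" for y
  proof -
    have "raw_has_prod (\<lambda>m. 1 - y ^ Suc m) 0 (exp (eval_log y))"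
      using euler_product[OF that] by (simp add: has_prod_def)
    then have "raw_has_prod (complex_of_real \<circ> (\<lambda>m. 1 - y ^ Suc m)) 0 (of_real (exp (eval_log y)))"
      by (simp only: raw_has_prod_of_real_iff)
    moreover have "complex_of_real \<circ> (\<lambda>m. 1 - y ^ Suc m) = (\<lambda>m. 1 - of_real y ^ Suc m)"
      by (rule ext) simp
    ultimately have "(\<lambda>m. 1 - of_real y ^ Suc m :: complex) has_prod of_real (exp (eval_log y))"
      unfolding has_prod_def by simp
    then show ?thesis by (rule has_prod_unique[symmetric])
  qed
  have "dedekind_eta \<tau> ^ 6 * dedekind_eta (3 * \<tau>) ^ 6
    = (exp (of_real (ln q) / 24) ^ 6 * exp (3 * of_real (ln q) / 24) ^ 6) * (of_real (exp (eval_log q)) ^ 6 * of_real (exp (eval_log (q ^ 3))) ^ 6)"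
  proof -
    have e3: "2 * of_real pi * \<i> * (3 * \<tau>) = 3 * of_real (ln q)" unfolding e[symmetric] by simp
    show ?thesis unfolding dedekind_eta_def n1 n3 prod[OF q] prod[OF q3] e e3
      by (simp only: power_mult_distrib mult_ac)
  qed
  also have "exp (of_real (ln q) / 24) ^ 6 * exp (3 * of_real (ln q) / 24) ^ 6 = (of_real q :: complex)"
  proof -
    have "exp (of_real (ln q) / 24) ^ 6 * exp (3 * of_real (ln q) / 24) ^ 6
      = (exp (of_nat 6 * (of_real (ln q) / 24) + of_nat 6 * (3 * of_real (ln q) / 24)) :: complex)"
      by (simp only: exp_of_nat_mult exp_add)
    also have "\<dots> = exp (of_real (ln q))" by (simp add: field_simps)
    also have "\<dots> = of_real q" using q by (simp add: exp_of_real)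
    finally show ?thesis .
  qed
  finally show "dedekind_eta \<tau> ^ 6 * dedekind_eta (3 * \<tau>) ^ 6
    = of_real (q * exp (eval_log q) ^ 6 * exp (eval_log (q ^ 3)) ^ 6)" by simp
qed

theorem theorem3p5:
  fixes a :: "nat \<Rightarrow> complex" and n :: nat
  assumes fourier: "\<And>\<tau>. Im \<tau> > 0 \<Longrightarrow>
    (\<lambda>m. a (Suc m) * nome \<tau> ^ Suc m) sums (dedekind_eta \<tau> ^ 6 * dedekind_eta (3 * \<tau>) ^ 6)"
  shows "of_nat (core_tuple_count 3 6 n) =
    1 / 39 * (of_nat (sigma_sharp_5_3 (n + 2)) - a (n + 2))"
proof -
  \<comment> \<open>The coefficients of \<open>G\<close> are the difference of the two sides of the theorem, multiplied by 39 and shifted by 2.\<close>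
  define H where "H = zeta3_fps 5 - fps_const 39 * (fps_X\<^sup>2 * core_fps ^ 6)"
  define G where "G m = of_real (fps_nth H m) - (if m = 0 then 0 else a m)" for m
  have "G (n + 2) = 0"
  proof (rule powser_real_unique)
    show "G 0 = 0" by (simp add: G_def H_def zeta3_fps_def lambert_def)
    fix q :: real assume q: "0 < q" "q < 1"
    let ?R = "q * exp (eval_log q) ^ 6 * exp (eval_log (q ^ 3)) ^ 6"
    let ?K = "exp (eval_log (q ^ 3)) ^ 3 / exp (eval_log q)"
    have cq: "ereal \<bar>q\<bar> < fps_conv_radius f" if "fps_conv_radius f \<ge> 1" for f :: "real fps"
      using eval_conv[OF that] q by simp
    have rad: "fps_conv_radius (core_fps ^ 6) \<ge> 1"
      using order_trans[OF core_fps_conv_radius fps_conv_radius_power] .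
    have rad2: "fps_conv_radius (fps_X\<^sup>2 * core_fps ^ 6) \<ge> 1"
      using rad order_trans[OF _ fps_conv_radius_mult, of 1 "fps_X\<^sup>2" "core_fps ^ 6"] by simp
    have K: "eval_fps core_fps q = ?K"
      using core_fps_sums[OF q] by (simp add: eval_fps_def sums_iff)
    have "eval_fps (fps_X\<^sup>2 * core_fps ^ 6) q = q\<^sup>2 * ?K ^ 6"
      using cq[OF rad] cq[OF core_fps_conv_radius] K by (simp add: eval_fps_mult eval_fps_power)
    then have s1: "(\<lambda>n. fps_nth (fps_X\<^sup>2 * core_fps ^ 6) n * q ^ n) sums (q\<^sup>2 * ?K ^ 6)"
      using sums_eval_fps[of q "fps_X\<^sup>2 * core_fps ^ 6"] cq[OF rad2] by simp
    have s2: "(\<lambda>n. fps_nth (zeta3_fps 5) n * q ^ n) sums (39 * q\<^sup>2 * ?K ^ 6 + ?R)"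
      using sums_eval_fps[of q "zeta3_fps 5"] cq[OF conv_radii(1)] zeta3_5_eq[OF q] by simp
    have "(\<lambda>n. fps_nth H n * q ^ n) sums ?R"
      using sums_diff[OF s2 sums_mult[OF s1, of 39]] by (simp add: H_def left_diff_distrib mult.assoc)
    then have sH: "(\<lambda>n. of_real (fps_nth H n) * of_real q ^ n :: complex) sums of_real ?R"
      using sums_of_real[where 'a = complex] by fastforce
    have "(\<lambda>m. a (Suc m) * of_real q ^ Suc m) sums of_real ?R"
      using fourier[OF nome_eta_real(1)[OF q]] unfolding nome_eta_real(2,3)[OF q] .
    then have "(\<lambda>m. (if Suc m = 0 then 0 else a (Suc m)) * of_real q ^ Suc m) sums of_real ?R"
      by (simp only: nat.distinct if_False)
    from sums_Suc[where f = "\<lambda>m. (if m = 0 then 0 else a m) * of_real q ^ m", OF this]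
    have sa: "(\<lambda>m. (if m = 0 then 0 else a m) * of_real q ^ m) sums of_real ?R"
      by (simp only: if_True mult_zero_left add_0_right simp_thms)
    have "(\<lambda>n. G n * of_real q ^ n) = (\<lambda>n. of_real (fps_nth H n) * of_real q ^ n - (if n = 0 then 0 else a n) * of_real q ^ n)"
      by (rule ext) (simp only: G_def left_diff_distrib)
    then show "(\<lambda>n. G n * of_real q ^ n) sums 0"
      using sums_diff[OF sH sa] by (simp only: diff_self)
  qed
  moreover have "fps_nth H (n + 2) = real (sigma_sharp_5_3 (n + 2)) - 39 * real (core_tuple_count 3 6 n)"
    by (simp add: H_def sigma_sharp_eq fps_X_power_mult_nth core_tuple_count_power)
  ultimately have "of_real (real (sigma_sharp_5_3 (n + 2)) - 39 * real (core_tuple_count 3 6 n)) - a (n + 2) = 0"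
    by (simp only: G_def) simp
  then show ?thesis by (simp add: field_simps)
qed

end
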